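(* Let $K/k$ be a finite Galois extension with Galois group $\mathcal{G}$, $N$ a finitely generated free abelian group, and $\Sigma$ a fan in $N$. The map $\pi\colon H^1(K/k,\mathrm{Aut}^{\mathsf T}_\Sigma)\to H^1(K/k,\mathrm{Aut}_\Sigma)$ induced by the projection $\mathbb{T}_N(K)\rtimes\mathrm{Aut}_\Sigma\to\mathrm{Aut}_\Sigma$ is surjective. The fiber of $\pi$ over the conjugacy class of a homomorphism $\varphi\colon\mathcal{G}\to\mathrm{Aut}_\Sigma$ is equal to the quotient of $H^1(K/k,{}_\varphi\mathscr{T})$ by the group $H^0(K/k,{}_\varphi\mathrm{Aut}_\Sigma)=C_{\mathrm{Aut}_\Sigma}(\varphi(\mathcal{G}))$, the centralizer of $\varphi(\mathcal{G})$ in $\mathrm{Aut}_\Sigma$. That is, $H^1(K/k,\mathrm{Aut}^{\mathsf T}_\Sigma)$ is partitioned as a disjoint union $$H^1(K/k,\mathrm{Aut}^{\mathsf T}_\Sigma)=\coprod_\varphi H^1(K/k,{}_\varphi\mathscr{T})\,/\,C_{\mathrm{Aut}_\Sigma}(\varphi(\mathcal{G})),$$ where $\varphi$ varies over representatives of conjugacy classes of homomorphisms $\varphi\colon\mathcal{G}\to\mathrm{Aut}_\Sigma$. In particular, the association of $\varphi$ to the class of the cocycle $\mathbf{1}_\varphi\colon g\mapsto(1,\varphi_g)$ is a section of $\pi$.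
   Context: $M=\mathrm{Hom}(N,\mathbb{Z})$; $\mathbb{T}_N=\mathrm{Spec}\,\mathbb{Z}[M]$ with $\mathbb{T}_N(K)=N\otimes K^\times$. $\mathrm{Aut}_\Sigma$ is the group of automorphisms of $N$ preserving the fan $\Sigma$, with trivial $\mathcal{G}$-action, and $\mathrm{Aut}^{\mathsf T}_\Sigma(K)=\mathbb{T}_N(K)\rtimes\mathrm{Aut}_\Sigma$ with $\mathcal{G}$ acting on $\mathbb{T}_N(K)$ through $K^\times$. For a group $A$ with $\mathcal{G}$-action, $H^1(K/k,A)=H^1(\mathcal{G},A)$ is the set of cocycles ($c_{gh}=c_g\cdot{}^gc_h$) modulo $c'_g=b^{-1}c_g\,{}^gb$; thus $H^1(K/k,\mathrm{Aut}_\Sigma)$ is the set of conjugacy classes of homomorphisms $\mathcal{G}\to\mathrm{Aut}_\Sigma$. Given $\varphi\colon\mathcal{G}\to\mathrm{Aut}_\Sigma\subset\mathrm{Aut}(N)$, ${}_\varphi\mathscr{T}$ is the $k$-torus with ${}_\varphi\mathscr{T}(K)=N\otimes K^\times$ on which $g\in\mathcal{G}$ acts diagonally: $g(n\otimes\lambda)=\varphi_g(n)\otimes g(\lambda)$; $H^1(K/k,{}_\varphi\mathscr{T})$ is the cohomology of $\mathcal{G}$ with coefficients in this module. ${}_\varphi\mathrm{Aut}_\Sigma$ is $\mathrm{Aut}_\Sigma$ with $g\in\mathcal{G}$ acting by conjugation by $\varphi_g$; its invariants are the centralizer of $\varphi(\mathcal{G})$, which acts on $H^1(K/k,{}_\varphi\mathscr{T})$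 through its natural action on ${}_\varphi\mathscr{T}(K)=N\otimes K^\times$ (which commutes with $\mathcal{G}$). The fiber is identified by sending the class of a cocycle $(t_g)$ of $\mathcal{G}$ in ${}_\varphi\mathscr{T}(K)$ to the class of $g\mapsto(t_g,\varphi_g)$. *)

theory Defs
  imports "HOL-Algebra.Algebra"
begin

section \<open>Galois extensions\<close>

definition galois_group :: "('a, 'b) ring_scheme \<Rightarrow> 'a set \<Rightarrow> ('a \<Rightarrow> 'a) monoid" where
  "galois_group K k =
     BijGroup (carrier K) \<lparr>carrier := {g \<in> ring_iso K K \<inter> extensional (carrier K). \<forall>x\<in>k. g x = x}\<rparr>"

definition finite_galois_extension :: "('a, 'b) ring_scheme \<Rightarrow> 'a set \<Rightarrow> bool" where
  "finite_galois_extension K k \<longleftrightarrow>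
     field K \<and> subfield k K \<and> ring.finite_dimension K k (carrier K) \<and>
     {x \<in> carrier K. \<forall>g \<in> carrier (galois_group K k). g x = x} = k"


section \<open>Lattices and tensor products of abelian groups\<close>

text \<open>Abelian groups are written multiplicatively, as always in \<open>HOL-Algebra\<close>.\<close>

definition fg_free_abelian :: "('n, 'm) monoid_scheme \<Rightarrow> bool" where
  "fg_free_abelian N \<longleftrightarrow> comm_group N \<and> (\<exists>r::nat. N \<cong> free_Abelian_group {..<r})"

definition tensor_relations ::
  "('a, 'm) monoid_scheme \<Rightarrow> ('b, 'l) monoid_scheme \<Rightarrow> ('a \<times> 'b \<Rightarrow>\<^sub>0 int) set" where
  "tensor_relations A B =
     generate (free_Abelian_group (carrier A \<times> carrier B))
       ({frag_of (a \<otimes>\<^bsub>A\<^esub> a', b) - frag_of (a, b) - frag_of (a', b) | a a' b.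
           a \<in> carrier A \<and> a' \<in> carrier A \<and> b \<in> carrier B} \<union>
        {frag_of (a, b \<otimes>\<^bsub>B\<^esub> b') - frag_of (a, b) - frag_of (a, b') | a b b'.
           a \<in> carrier A \<and> b \<in> carrier B \<and> b' \<in> carrier B})"

definition tensor_group ::
  "('a, 'm) monoid_scheme \<Rightarrow> ('b, 'l) monoid_scheme \<Rightarrow> ('a \<times> 'b \<Rightarrow>\<^sub>0 int) set monoid" where
  "tensor_group A B = free_Abelian_group (carrier A \<times> carrier B) Mod tensor_relations A B"

definition tensor_elem ::
  "('a, 'm) monoid_scheme \<Rightarrow> ('b, 'l) monoid_scheme \<Rightarrow> 'a \<Rightarrow> 'b \<Rightarrow> ('a \<times> 'b \<Rightarrow>\<^sub>0 int) set" where
  "tensor_elem A B a b =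
     tensor_relations A B #>\<^bsub>free_Abelian_group (carrier A \<times> carrier B)\<^esub> frag_of (a, b)"

text \<open>For endomorphisms \<open>f\<close> of \<open>A\<close> and \<open>h\<close> of \<open>B\<close>, the endomorphism of the tensor product
  with \<open>a \<otimes> b \<mapsto> f a \<otimes> h b\<close>. All cosets in the union coincide, so the union is that coset.\<close>

definition tensor_map ::
  "('a, 'm) monoid_scheme \<Rightarrow> ('b, 'l) monoid_scheme \<Rightarrow> ('a \<Rightarrow> 'a) \<Rightarrow> ('b \<Rightarrow> 'b)
     \<Rightarrow> ('a \<times> 'b \<Rightarrow>\<^sub>0 int) set \<Rightarrow> ('a \<times> 'b \<Rightarrow>\<^sub>0 int) set" where
  "tensor_map A B f h C =
     (\<Union>x\<in>C. tensor_relations A B #>\<^bsub>free_Abelian_group (carrier A \<times> carrier B)\<^esub>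
               frag_extend (\<lambda>(a, b). frag_of (f a, h b)) x)"


section \<open>Fans\<close>

definition real_group :: "real monoid" where
  "real_group = \<lparr>carrier = UNIV, monoid.mult = (+), one = 0\<rparr>"

type_synonym 'n real_ext = "('n \<times> real \<Rightarrow>\<^sub>0 int) set"

definition lattice_real :: "('n, 'm) monoid_scheme \<Rightarrow> 'n real_ext monoid" where
  "lattice_real N = tensor_group N real_group"

definition linear_forms :: "('n, 'm) monoid_scheme \<Rightarrow> ('n real_ext \<Rightarrow> real) set" where
  "linear_forms N =
     {u \<in> hom (lattice_real N) real_group.
        \<forall>r. \<forall>x \<in> carrier (lattice_real N). u (tensor_map N real_group id ((*) r) x) = r * u x}"

definition rational_cone :: "('n, 'm) monoid_scheme \<Rightarrow> 'n real_ext set \<Rightarrow> bool" where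
  "rational_cone N \<sigma> \<longleftrightarrow>
     (\<exists>S. finite S \<and> S \<subseteq> carrier N \<and>
        \<sigma> = {finprod (lattice_real N) (\<lambda>v. tensor_elem N real_group v (r v)) S | r.
               \<forall>v\<in>S. (0::real) \<le> r v})"

definition strongly_convex :: "('n, 'm) monoid_scheme \<Rightarrow> 'n real_ext set \<Rightarrow> bool" where
  "strongly_convex N \<sigma> \<longleftrightarrow>
     \<sigma> \<inter> {inv\<^bsub>lattice_real N\<^esub> x | x. x \<in> \<sigma>} = {\<one>\<^bsub>lattice_real N\<^esub>}"

definition cone_face :: "('n, 'm) monoid_scheme \<Rightarrow> 'n real_ext set \<Rightarrow> 'n real_ext set \<Rightarrow> bool" where
  "cone_face N \<tau> \<sigma> \<longleftrightarrow>
     (\<exists>u \<in> linear_forms N. (\<forall>x\<in>\<sigma>. 0 \<le> u x) \<and> \<tau> = {x \<in> \<sigma>. u x = 0})"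

definition fan :: "('n, 'm) monoid_scheme \<Rightarrow> 'n real_ext set set \<Rightarrow> bool" where
  "fan N \<Sigma> \<longleftrightarrow>
     finite \<Sigma> \<and>
     (\<forall>\<sigma>\<in>\<Sigma>. rational_cone N \<sigma> \<and> strongly_convex N \<sigma>) \<and>
     (\<forall>\<sigma>\<in>\<Sigma>. \<forall>\<tau>. cone_face N \<tau> \<sigma> \<longrightarrow> \<tau> \<in> \<Sigma>) \<and>
     (\<forall>\<sigma>\<in>\<Sigma>. \<forall>\<tau>\<in>\<Sigma>. cone_face N (\<sigma> \<inter> \<tau>) \<sigma> \<and> cone_face N (\<sigma> \<inter> \<tau>) \<tau>)"

definition fan_aut :: "('n, 'm) monoid_scheme \<Rightarrow> 'n real_ext set set \<Rightarrow> ('n \<Rightarrow> 'n) monoid" where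
  "fan_aut N \<Sigma> =
     AutoGroup N \<lparr>carrier := {a \<in> auto N. (\<lambda>\<sigma>. tensor_map N real_group a id ` \<sigma>) ` \<Sigma> = \<Sigma>}\<rparr>"


section \<open>Group cohomology in degrees 0 and 1, with possibly nonabelian coefficients\<close>

text \<open>\<open>act\<close> is the action of the group \<open>G\<close> on the group \<open>A\<close> by automorphisms. Cochains and
  homomorphisms are extensional, so that they are equal iff they agree on the carrier of \<open>G\<close>.\<close>

definition H0 ::
  "('g, 'm) monoid_scheme \<Rightarrow> ('a, 'l) monoid_scheme \<Rightarrow> ('g \<Rightarrow> 'a \<Rightarrow> 'a) \<Rightarrow> 'a set" where
  "H0 G A act = {a \<in> carrier A. \<forall>g \<in> carrier G. act g a = a}"

definition Z1 ::
  "('g, 'm) monoid_scheme \<Rightarrow> ('a, 'l) monoid_scheme \<Rightarrow> ('g \<Rightarrow> 'a \<Rightarrow> 'a) \<Rightarrow> ('g \<Rightarrow> 'a) set" where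
  "Z1 G A act =
     {c \<in> carrier G \<rightarrow>\<^sub>E carrier A.
        \<forall>g \<in> carrier G. \<forall>h \<in> carrier G. c (g \<otimes>\<^bsub>G\<^esub> h) = c g \<otimes>\<^bsub>A\<^esub> act g (c h)}"

definition cohomologous ::
  "('g, 'm) monoid_scheme \<Rightarrow> ('a, 'l) monoid_scheme \<Rightarrow> ('g \<Rightarrow> 'a \<Rightarrow> 'a)
     \<Rightarrow> (('g \<Rightarrow> 'a) \<times> ('g \<Rightarrow> 'a)) set" where
  "cohomologous G A act =
     {(c, c'). c \<in> Z1 G A act \<and> c' \<in> Z1 G A act \<and>
        (\<exists>b \<in> carrier A. \<forall>g \<in> carrier G. c' g = inv\<^bsub>A\<^esub> b \<otimes>\<^bsub>A\<^esub> c g \<otimes>\<^bsub>A\<^esub> act g b)}"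

definition H1 ::
  "('g, 'm) monoid_scheme \<Rightarrow> ('a, 'l) monoid_scheme \<Rightarrow> ('g \<Rightarrow> 'a \<Rightarrow> 'a)
     \<Rightarrow> ('g \<Rightarrow> 'a) set set" where
  "H1 G A act = Z1 G A act // cohomologous G A act"

definition H1_class ::
  "('g, 'm) monoid_scheme \<Rightarrow> ('a, 'l) monoid_scheme \<Rightarrow> ('g \<Rightarrow> 'a \<Rightarrow> 'a)
     \<Rightarrow> ('g \<Rightarrow> 'a) \<Rightarrow> ('g \<Rightarrow> 'a) set" where
  "H1_class G A act c = cohomologous G A act `` {c}"

text \<open>The map on cohomology induced by an equivariant homomorphism \<open>f\<close> into \<open>A\<close>, sending the
  class of \<open>c\<close> to the class of \<open>f \<circ> c\<close>. All classes in the union coincide.\<close>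

definition H1_map ::
  "('g, 'm) monoid_scheme \<Rightarrow> ('a, 'l) monoid_scheme \<Rightarrow> ('g \<Rightarrow> 'a \<Rightarrow> 'a)
     \<Rightarrow> ('c \<Rightarrow> 'a) \<Rightarrow> ('g \<Rightarrow> 'c) set \<Rightarrow> ('g \<Rightarrow> 'a) set" where
  "H1_map G A act f C = (\<Union>c\<in>C. H1_class G A act (\<lambda>g \<in> carrier G. f (c g)))"

definition ext_hom ::
  "('g, 'm) monoid_scheme \<Rightarrow> ('a, 'l) monoid_scheme \<Rightarrow> ('g \<Rightarrow> 'a) set" where
  "ext_hom G A = hom G A \<inter> extensional (carrier G)"

definition conjugate_homs ::
  "('g, 'm) monoid_scheme \<Rightarrow> ('a, 'l) monoid_scheme \<Rightarrow> ('g \<Rightarrow> 'a) \<Rightarrow> ('g \<Rightarrow> 'a) \<Rightarrow> bool" where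
  "conjugate_homs G A \<phi> \<psi> \<longleftrightarrow>
     (\<exists>a \<in> carrier A. \<forall>g \<in> carrier G. \<psi> g = inv\<^bsub>A\<^esub> a \<otimes>\<^bsub>A\<^esub> \<phi> g \<otimes>\<^bsub>A\<^esub> a)"

definition hom_class_reps ::
  "('g, 'm) monoid_scheme \<Rightarrow> ('a, 'l) monoid_scheme \<Rightarrow> ('g \<Rightarrow> 'a) set \<Rightarrow> bool" where
  "hom_class_reps G A R \<longleftrightarrow>
     R \<subseteq> ext_hom G A \<and> (\<forall>\<phi> \<in> ext_hom G A. \<exists>!\<rho>. \<rho> \<in> R \<and> conjugate_homs G A \<phi> \<rho>)"

definition centralizer :: "('a, 'l) monoid_scheme \<Rightarrow> 'a set \<Rightarrow> 'a set" where
  "centralizer A S = {a \<in> carrier A. \<forall>s\<in>S. a \<otimes>\<^bsub>A\<^esub> s = s \<otimes>\<^bsub>A\<^esub> a}"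

text \<open>The semidirect product with normal factor \<open>T\<close>, on which \<open>A\<close> acts by \<open>act\<close>.\<close>

definition semidirect ::
  "('t, 'm) monoid_scheme \<Rightarrow> ('a, 'l) monoid_scheme \<Rightarrow> ('a \<Rightarrow> 't \<Rightarrow> 't) \<Rightarrow> ('t \<times> 'a) monoid" where
  "semidirect T A act =
     \<lparr>carrier = carrier T \<times> carrier A,
      monoid.mult = (\<lambda>(t, a) (t', a'). (t \<otimes>\<^bsub>T\<^esub> act a t', a \<otimes>\<^bsub>A\<^esub> a')),
      one = (\<one>\<^bsub>T\<^esub>, \<one>\<^bsub>A\<^esub>)\<rparr>"


section \<open>Toric automorphisms and twisted tori\<close>

type_synonym ('n, 'a) torus_point = "('n \<times> 'a \<Rightarrow>\<^sub>0 int) set"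

definition torus :: "('n, 'm) monoid_scheme \<Rightarrow> ('a, 'b) ring_scheme \<Rightarrow> ('n, 'a) torus_point monoid" where
  "torus N K = tensor_group N (units_of K)"

definition toric_aut ::
  "('n, 'm) monoid_scheme \<Rightarrow> 'n real_ext set set \<Rightarrow> ('a, 'b) ring_scheme
     \<Rightarrow> (('n, 'a) torus_point \<times> ('n \<Rightarrow> 'n)) monoid" where
  "toric_aut N \<Sigma> K =
     semidirect (torus N K) (fan_aut N \<Sigma>) (\<lambda>a. tensor_map N (units_of K) a id)"

definition toric_act ::
  "('n, 'm) monoid_scheme \<Rightarrow> ('a, 'b) ring_scheme \<Rightarrow> ('a \<Rightarrow> 'a)
     \<Rightarrow> ('n, 'a) torus_point \<times> ('n \<Rightarrow> 'n) \<Rightarrow> ('n, 'a) torus_point \<times> ('n \<Rightarrow> 'n)" where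
  "toric_act N K g = (\<lambda>(t, a). (tensor_map N (units_of K) id g t, a))"

definition trivial_act :: "'g \<Rightarrow> 'a \<Rightarrow> 'a" where
  "trivial_act g a = a"

definition twisted_torus_act ::
  "('n, 'm) monoid_scheme \<Rightarrow> ('a, 'b) ring_scheme \<Rightarrow> (('a \<Rightarrow> 'a) \<Rightarrow> 'n \<Rightarrow> 'n)
     \<Rightarrow> ('a \<Rightarrow> 'a) \<Rightarrow> ('n, 'a) torus_point \<Rightarrow> ('n, 'a) torus_point" where
  "twisted_torus_act N K \<phi> g = tensor_map N (units_of K) (\<phi> g) g"

definition twisted_fan_aut_act ::
  "('n, 'm) monoid_scheme \<Rightarrow> 'n real_ext set set \<Rightarrow> (('a \<Rightarrow> 'a) \<Rightarrow> 'n \<Rightarrow> 'n)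
     \<Rightarrow> ('a \<Rightarrow> 'a) \<Rightarrow> ('n \<Rightarrow> 'n) \<Rightarrow> ('n \<Rightarrow> 'n)" where
  "twisted_fan_aut_act N \<Sigma> \<phi> g a = \<phi> g \<otimes>\<^bsub>fan_aut N \<Sigma>\<^esub> a \<otimes>\<^bsub>fan_aut N \<Sigma>\<^esub> inv\<^bsub>fan_aut N \<Sigma>\<^esub> (\<phi> g)"

abbreviation "Z1_fan K k N \<Sigma> \<equiv> Z1 (galois_group K k) (fan_aut N \<Sigma>) trivial_act"
abbreviation "H1_fan K k N \<Sigma> \<equiv> H1 (galois_group K k) (fan_aut N \<Sigma>) trivial_act"
abbreviation "class_fan K k N \<Sigma> \<equiv> H1_class (galois_group K k) (fan_aut N \<Sigma>) trivial_act"

abbreviation "Z1_toric K k N \<Sigma> \<equiv> Z1 (galois_group K k) (toric_aut N \<Sigma> K) (toric_act N K)"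
abbreviation "H1_toric K k N \<Sigma> \<equiv> H1 (galois_group K k) (toric_aut N \<Sigma> K) (toric_act N K)"
abbreviation "class_toric K k N \<Sigma> \<equiv> H1_class (galois_group K k) (toric_aut N \<Sigma> K) (toric_act N K)"

abbreviation "Z1_twisted K k N \<phi> \<equiv> Z1 (galois_group K k) (torus N K) (twisted_torus_act N K \<phi>)"
abbreviation "H1_twisted K k N \<phi> \<equiv> H1 (galois_group K k) (torus N K) (twisted_torus_act N K \<phi>)"
abbreviation "class_twisted K k N \<phi> \<equiv> H1_class (galois_group K k) (torus N K) (twisted_torus_act N K \<phi>)"

definition H1_proj where
  "H1_proj K k N \<Sigma> = H1_map (galois_group K k) (fan_aut N \<Sigma>) trivial_act snd"

definition fan_centralizer where
  "fan_centralizer K k N \<Sigma> \<phi> =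
     fan_aut N \<Sigma> \<lparr>carrier := centralizer (fan_aut N \<Sigma>) (\<phi> ` carrier (galois_group K k))\<rparr>"

definition centralizer_act where
  "centralizer_act K k N \<phi> a =
     (\<lambda>C \<in> H1_twisted K k N \<phi>.
        H1_map (galois_group K k) (torus N K) (twisted_torus_act N K \<phi>)
          (tensor_map N (units_of K) a id) C)"

definition H1_twisted_quotient where
  "H1_twisted_quotient K k N \<Sigma> \<phi> =
     orbits (fan_centralizer K k N \<Sigma> \<phi>) (H1_twisted K k N \<phi>) (centralizer_act K k N \<phi>)"

definition pair_cocycle where
  "pair_cocycle K k \<phi> t = (\<lambda>g \<in> carrier (galois_group K k). (t g, \<phi> g))"

definition one_cocycle where
  "one_cocycle K k N \<phi> = (\<lambda>g \<in> carrier (galois_group K k). (\<one>\<^bsub>torus N K\<^esub>, \<phi> g))"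

text \<open>The map sending the orbit of the class of \<open>t\<close> to the class of \<open>g \<mapsto> (t\<^sub>g, \<phi>\<^sub>g)\<close>, and the
  map sending the class of \<open>\<phi>\<close> to the class of \<open>g \<mapsto> (1, \<phi>\<^sub>g)\<close>; again all classes in each union
  coincide.\<close>

definition fiber_map where
  "fiber_map K k N \<Sigma> \<phi> Q =
     (\<Union>C\<in>Q. \<Union>t\<in>C. class_toric K k N \<Sigma> (pair_cocycle K k \<phi> t))"

definition H1_section where
  "H1_section K k N \<Sigma> C = (\<Union>\<phi>\<in>C. class_toric K k N \<Sigma> (one_cocycle K k N \<phi>))"

end

theory Submission
  imports Defs
begin

text \<open>
  The statement is an instance of a fact about a semidirect product \<open>T \<rtimes> A\<close> with \<open>T = N \<otimes> K\<^sup>\<times>\<close>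
  and \<open>A\<close> the automorphism group of the fan. The facts behind it are that the actions of \<open>A\<close> and of the
  Galois group \<open>G\<close> on \<open>T\<close> commute, and that \<open>G\<close> acts trivially on \<open>A\<close>.

  A map \<open>g \<mapsto> (t\<^sub>g, \<phi>\<^sub>g)\<close> is a cocycle in \<open>T \<rtimes> A\<close> exactly when \<open>\<phi>\<close> is a homomorphism and \<open>t\<close> is a
  cocycle for the action on \<open>T\<close> twisted by \<open>\<phi>\<close> (\<open>paired_in_Z1_iff\<close>). Taking \<open>t = 1\<close> gives the
  section, hence surjectivity of the projection. A coboundary by \<open>(s, a)\<close> conjugates \<open>\<phi>\<close> by \<open>a\<close>. So every
  class over the class of \<open>\<phi>\<close> is represented by a cocycle whose second component is \<open>\<phi>\<close> itself, and
  two such cocycles are cohomologous through \<open>(s, a)\<close> only if \<open>a\<close> centralizes the image of \<open>\<phi>\<close>. In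
  that case the relation between their first components says that \<open>t\<close> is cohomologous, by \<open>s\<close>,
  to the translate of \<open>t'\<close> by \<open>a\<close> (\<open>paired_class_eq_iff\<close>). Thus the fiber is the set of orbits
  of the centralizer on the cohomology of the twisted module (\<open>bij_betw_fiber_class\<close>), and
  collecting the fibers over all conjugacy classes gives the partition
  (\<open>bij_betw_partition\<close>).

  To reach this situation from the theorem, functoriality of the tensor product is needed
  (\<open>tensor_map_comp\<close>): it yields the two commuting actions on \<open>N \<otimes> K\<^sup>\<times>\<close>, and, for
  \<open>N \<otimes> \<real>\<close>, the group structure on the automorphisms of the fan.
\<close>

section \<open>Nonabelian cohomology in degree one\<close>

locale group_with_action = acting: group G + coeff: group A
  for G :: "('g, 'm) monoid_scheme" and A :: "('a, 'l) monoid_scheme" +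
  fixes act :: "'g \<Rightarrow> 'a \<Rightarrow> 'a"
  assumes act_hom: "g \<in> carrier G \<Longrightarrow> act g \<in> hom A A"
    and act_mult: "\<lbrakk>g \<in> carrier G; h \<in> carrier G; a \<in> carrier A\<rbrakk> \<Longrightarrow> act (g \<otimes>\<^bsub>G\<^esub> h) a = act g (act h a)"
    and act_one: "a \<in> carrier A \<Longrightarrow> act \<one>\<^bsub>G\<^esub> a = a"
begin

lemma act_closed [simp]: "g \<in> carrier G \<Longrightarrow> a \<in> carrier A \<Longrightarrow> act g a \<in> carrier A"
  using act_hom by (auto simp: hom_def)

lemma act_distrib: "g \<in> carrier G \<Longrightarrow> a \<in> carrier A \<Longrightarrow> b \<in> carrier A \<Longrightarrow>
    act g (a \<otimes>\<^bsub>A\<^esub> b) = act g a \<otimes>\<^bsub>A\<^esub> act g b"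
  using act_hom by (auto simp: hom_def)

lemma act_group_hom: "g \<in> carrier G \<Longrightarrow> group_hom A A (act g)"
  by (simp add: group_hom_def group_hom_axioms_def act_hom coeff.group_axioms)

lemma act_inv: "g \<in> carrier G \<Longrightarrow> a \<in> carrier A \<Longrightarrow> act g (inv\<^bsub>A\<^esub> a) = inv\<^bsub>A\<^esub> (act g a)"
  by (rule group_hom.hom_inv[OF act_group_hom])

lemma act_unit: "g \<in> carrier G \<Longrightarrow> act g \<one>\<^bsub>A\<^esub> = \<one>\<^bsub>A\<^esub>"
  by (rule group_hom.hom_one[OF act_group_hom])

lemma Z1_closed: "c \<in> Z1 G A act \<Longrightarrow> g \<in> carrier G \<Longrightarrow> c g \<in> carrier A"
  by (auto simp: Z1_def)

text \<open>Clearing the inverse spares all later arguments the formula for inverses in a semidirect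
  product.\<close>
lemma cohomologous_iff:
  assumes "c \<in> Z1 G A act" "c' \<in> Z1 G A act"
  shows "(c, c') \<in> cohomologous G A act \<longleftrightarrow>
    (\<exists>b \<in> carrier A. \<forall>g \<in> carrier G. b \<otimes>\<^bsub>A\<^esub> c' g = c g \<otimes>\<^bsub>A\<^esub> act g b)"
proof -
  have "c' g = inv\<^bsub>A\<^esub> b \<otimes>\<^bsub>A\<^esub> c g \<otimes>\<^bsub>A\<^esub> act g b \<longleftrightarrow> b \<otimes>\<^bsub>A\<^esub> c' g = c g \<otimes>\<^bsub>A\<^esub> act g b"
    if "b \<in> carrier A" "g \<in> carrier G" for b g
    using that assms by (metis coeff.inv_closed coeff.inv_solve_left' coeff.m_assoc coeff.m_closed Z1_closed act_closed)
  then show ?thesis using assms by (auto simp: cohomologous_def)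
qed

text \<open>Every element \<open>b\<close> changes a cocycle into a cohomologous one; the inner factors
  \<open>\<^sup>gb\<close> and \<open>(\<^sup>gb)\<^sup>-\<^sup>1\<close> cancel in the cocycle identity.\<close>
lemma Z1_coboundary_twist:
  assumes c: "c \<in> Z1 G A act" and b: "b \<in> carrier A"
  shows "(\<lambda>g\<in>carrier G. inv\<^bsub>A\<^esub> b \<otimes>\<^bsub>A\<^esub> c g \<otimes>\<^bsub>A\<^esub> act g b) \<in> Z1 G A act"
    and "(c, \<lambda>g\<in>carrier G. inv\<^bsub>A\<^esub> b \<otimes>\<^bsub>A\<^esub> c g \<otimes>\<^bsub>A\<^esub> act g b) \<in> cohomologous G A act"
proof -
  let ?d = "\<lambda>g\<in>carrier G. inv\<^bsub>A\<^esub> b \<otimes>\<^bsub>A\<^esub> c g \<otimes>\<^bsub>A\<^esub> act g b"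
  have "?d (g \<otimes>\<^bsub>G\<^esub> h) = ?d g \<otimes>\<^bsub>A\<^esub> act g (?d h)" if "g \<in> carrier G" "h \<in> carrier G" for g h
  proof -
    have [simp]: "act g b \<otimes>\<^bsub>A\<^esub> (inv\<^bsub>A\<^esub> (act g b) \<otimes>\<^bsub>A\<^esub> x) = x" if "x \<in> carrier A" for x
      using that \<open>g \<in> carrier G\<close> b by (metis coeff.inv_closed coeff.l_one coeff.m_assoc coeff.r_inv act_closed)
    have "c (g \<otimes>\<^bsub>G\<^esub> h) = c g \<otimes>\<^bsub>A\<^esub> act g (c h)" using c that by (auto simp: Z1_def)
    then show ?thesis
      using that b by (simp add: Z1_closed[OF c] act_distrib act_inv act_mult coeff.m_assoc)
  qed
  then show d: "?d \<in> Z1 G A act"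
    using b c unfolding Z1_def[of _ _ act] by (auto simp: Z1_closed[OF c])
  show "(c, ?d) \<in> cohomologous G A act"
    using b c d by (auto simp: cohomologous_def)
qed

lemma equiv_cohomologous: "equiv (Z1 G A act) (cohomologous G A act)"
proof (rule equivI)
  show "cohomologous G A act \<subseteq> Z1 G A act \<times> Z1 G A act" by (auto simp: cohomologous_def)
  show "refl_on (Z1 G A act) (cohomologous G A act)"
  proof (rule refl_onI)
    fix c assume c: "c \<in> Z1 G A act"
    show "(c, c) \<in> cohomologous G A act"
      unfolding cohomologous_iff[OF c c]
      by (rule bexI[of _ "\<one>\<^bsub>A\<^esub>"]) (simp_all add: Z1_closed[OF c] act_unit)
  qed
  show "sym (cohomologous G A act)"
  proof (rule symI)
    fix c c' assume cc: "(c, c') \<in> cohomologous G A act"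
    then have Z: "c \<in> Z1 G A act" "c' \<in> Z1 G A act" by (auto simp: cohomologous_def)
    obtain b where b: "b \<in> carrier A" "\<And>g. g \<in> carrier G \<Longrightarrow> b \<otimes>\<^bsub>A\<^esub> c' g = c g \<otimes>\<^bsub>A\<^esub> act g b"
      using cc cohomologous_iff[OF Z] by blast
    have "inv\<^bsub>A\<^esub> b \<otimes>\<^bsub>A\<^esub> c g = c' g \<otimes>\<^bsub>A\<^esub> act g (inv\<^bsub>A\<^esub> b)" if "g \<in> carrier G" for g
    proof -
      have cl: "c g \<in> carrier A" "c' g \<in> carrier A" "act g b \<in> carrier A" using b(1) that Z1_closed[OF Z(1)] Z1_closed[OF Z(2)] by auto
      have "inv\<^bsub>A\<^esub> b \<otimes>\<^bsub>A\<^esub> c g = inv\<^bsub>A\<^esub> b \<otimes>\<^bsub>A\<^esub> (c g \<otimes>\<^bsub>A\<^esub> act g b) \<otimes>\<^bsub>A\<^esub> inv\<^bsub>A\<^esub> (act g b)"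
        using cl b(1) by (simp add: coeff.m_assoc)
      also have "\<dots> = inv\<^bsub>A\<^esub> b \<otimes>\<^bsub>A\<^esub> (b \<otimes>\<^bsub>A\<^esub> c' g) \<otimes>\<^bsub>A\<^esub> inv\<^bsub>A\<^esub> (act g b)"
        using b(2)[OF that] by simp
      also have "\<dots> = c' g \<otimes>\<^bsub>A\<^esub> act g (inv\<^bsub>A\<^esub> b)"
        using cl b(1) that by (simp add: coeff.m_assoc[symmetric] act_inv)
      finally show ?thesis .
    qed
    then show "(c', c) \<in> cohomologous G A act"
      using cohomologous_iff[OF Z(2,1)] b(1) by blast
  qed
  show "trans (cohomologous G A act)"
  proof (rule transI)
    fix c c' c'' assume cc: "(c, c') \<in> cohomologous G A act" "(c', c'') \<in> cohomologous G A act"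
    then have Z: "c \<in> Z1 G A act" "c' \<in> Z1 G A act" "c'' \<in> Z1 G A act" by (auto simp: cohomologous_def)
    obtain b where b: "b \<in> carrier A" "\<And>g. g \<in> carrier G \<Longrightarrow> b \<otimes>\<^bsub>A\<^esub> c' g = c g \<otimes>\<^bsub>A\<^esub> act g b"
      using cc(1) cohomologous_iff[OF Z(1,2)] by blast
    obtain b' where b': "b' \<in> carrier A" "\<And>g. g \<in> carrier G \<Longrightarrow> b' \<otimes>\<^bsub>A\<^esub> c'' g = c' g \<otimes>\<^bsub>A\<^esub> act g b'"
      using cc(2) cohomologous_iff[OF Z(2,3)] by blast
    have "(b \<otimes>\<^bsub>A\<^esub> b') \<otimes>\<^bsub>A\<^esub> c'' g = c g \<otimes>\<^bsub>A\<^esub> act g (b \<otimes>\<^bsub>A\<^esub> b')" if g: "g \<in> carrier G" for g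
      using b b' Z g by (metis coeff.m_assoc Z1_closed act_closed act_distrib)
    then show "(c, c'') \<in> cohomologous G A act"
      using cohomologous_iff[OF Z(1,3)] b(1) b'(1) by blast
  qed
qed

lemma H1_class_in_H1: "c \<in> Z1 G A act \<Longrightarrow> H1_class G A act c \<in> H1 G A act"
  by (simp add: H1_def H1_class_def quotientI)

lemma H1E:
  assumes "C \<in> H1 G A act" obtains c where "c \<in> Z1 G A act" "C = H1_class G A act c"
  using assms by (auto simp: H1_def H1_class_def elim: quotientE)

lemma H1_class_self: "c \<in> Z1 G A act \<Longrightarrow> c \<in> H1_class G A act c"
  unfolding H1_class_def by (rule equiv_class_self[OF equiv_cohomologous])

lemma H1_class_eq_iff:
  "c \<in> Z1 G A act \<Longrightarrow> c' \<in> Z1 G A act \<Longrightarrow>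
   H1_class G A act c = H1_class G A act c' \<longleftrightarrow> (c, c') \<in> cohomologous G A act"
  unfolding H1_class_def by (rule eq_equiv_class_iff[OF equiv_cohomologous])

text \<open>Maps on cohomology are given as unions over all representatives of a class; a function of
  cocycles that is constant on classes turns such a union into its value at one representative.\<close>
lemma UN_H1_class_const:
  assumes "c \<in> Z1 G A act"
    and "\<And>c'. (c, c') \<in> cohomologous G A act \<Longrightarrow> f c' = f c"
  shows "(\<Union>c'\<in>H1_class G A act c. f c') = f c"
proof -
  have "f c' = f c" if "c' \<in> H1_class G A act c" for c'
    using that assms(2) by (simp add: H1_class_def)
  with H1_class_self[OF assms(1)] show ?thesis by blast
qed

end

text \<open>Cohomology sees an action only on the carriers. This allows replacing the diagonal action on
  \<open>N \<otimes> K\<^sup>\<times>\<close> by a composite of two actions that agrees with it there.\<close>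
lemma Z1_cong:
  assumes "\<And>g a. g \<in> carrier G \<Longrightarrow> a \<in> carrier A \<Longrightarrow> act g a = act' g a"
  shows "Z1 G A act = Z1 G A act'"
  unfolding Z1_def by (rule Collect_cong) (use assms in \<open>auto simp: PiE_iff\<close>)

lemma cohomologous_cong:
  assumes "\<And>g a. g \<in> carrier G \<Longrightarrow> a \<in> carrier A \<Longrightarrow> act g a = act' g a"
  shows "cohomologous G A act = cohomologous G A act'"
proof -
  have Z: "Z1 G A act = Z1 G A act'" using assms by (rule Z1_cong)
  have "(\<exists>b\<in>carrier A. \<forall>g\<in>carrier G. c' g = inv\<^bsub>A\<^esub> b \<otimes>\<^bsub>A\<^esub> c g \<otimes>\<^bsub>A\<^esub> act g b) \<longleftrightarrow>
    (\<exists>b\<in>carrier A. \<forall>g\<in>carrier G. c' g = inv\<^bsub>A\<^esub> b \<otimes>\<^bsub>A\<^esub> c g \<otimes>\<^bsub>A\<^esub> act' g b)" for c c'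
    by (intro bex_cong ball_cong refl) (simp add: assms)
  then show ?thesis unfolding cohomologous_def Z by simp
qed

locale equivariant_hom =
  S: group_with_action G B actB + T: group_with_action G A actA
  for G :: "('g, 'm) monoid_scheme" and B :: "('b, 'k) monoid_scheme" and actB
    and A :: "('a, 'l) monoid_scheme" and actA +
  fixes f :: "'b \<Rightarrow> 'a"
  assumes hom: "f \<in> hom B A"
    and equivariant: "\<lbrakk>g \<in> carrier G; b \<in> carrier B\<rbrakk> \<Longrightarrow> f (actB g b) = actA g (f b)"
begin

lemma Z1_image:
  assumes "c \<in> Z1 G B actB" shows "(\<lambda>g\<in>carrier G. f (c g)) \<in> Z1 G A actA"
proof -
  have "f (c (g \<otimes>\<^bsub>G\<^esub> h)) = f (c g) \<otimes>\<^bsub>A\<^esub> actA g (f (c h))"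
    if gh: "g \<in> carrier G" "h \<in> carrier G" for g h
  proof -
    have "c (g \<otimes>\<^bsub>G\<^esub> h) = c g \<otimes>\<^bsub>B\<^esub> actB g (c h)" using assms gh by (simp add: Z1_def)
    then show ?thesis
      using gh by (simp add: S.Z1_closed[OF assms] hom_mult[OF hom] equivariant)
  qed
  then show ?thesis
    using hom_in_carrier[OF hom] S.Z1_closed[OF assms] by (simp add: Z1_def[of G A])
qed

lemma cohomologous_image:
  assumes "(c, c') \<in> cohomologous G B actB"
  shows "(\<lambda>g\<in>carrier G. f (c g), \<lambda>g\<in>carrier G. f (c' g)) \<in> cohomologous G A actA"
proof -
  have Z: "c \<in> Z1 G B actB" "c' \<in> Z1 G B actB" using assms by (auto simp: cohomologous_def)
  obtain b where b: "b \<in> carrier B" "\<And>g. g \<in> carrier G \<Longrightarrow> b \<otimes>\<^bsub>B\<^esub> c' g = c g \<otimes>\<^bsub>B\<^esub> actB g b"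
    using assms S.cohomologous_iff[OF Z] by blast
  have "f b \<otimes>\<^bsub>A\<^esub> f (c' g) = f (c g) \<otimes>\<^bsub>A\<^esub> actA g (f b)" if "g \<in> carrier G" for g
    using b that Z by (metis hom_mult[OF hom] equivariant S.Z1_closed S.act_closed)
  then show ?thesis
    using T.cohomologous_iff[OF Z1_image[OF Z(1)] Z1_image[OF Z(2)]] hom_in_carrier[OF hom b(1)] by auto
qed

lemma H1_map_class:
  assumes "c \<in> Z1 G B actB"
  shows "H1_map G A actA f (H1_class G B actB c) = H1_class G A actA (\<lambda>g\<in>carrier G. f (c g))"
  unfolding H1_map_def
proof (rule S.UN_H1_class_const[OF assms])
  fix c' assume c': "(c, c') \<in> cohomologous G B actB"
  then have "c' \<in> Z1 G B actB" by (auto simp: cohomologous_def)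
  with cohomologous_image[OF c'] show "H1_class G A actA (\<lambda>g\<in>carrier G. f (c' g)) = H1_class G A actA (\<lambda>g\<in>carrier G. f (c g))"
    using T.H1_class_eq_iff[OF Z1_image Z1_image] assms by metis
qed

end

section \<open>Semidirect products with commuting actions\<close>

text \<open>The situation of the theorem without its geometry: \<open>A\<close> and \<open>G\<close> act on a group \<open>T\<close> by
  automorphisms, and the two actions commute. The group \<open>G\<close> acts trivially on \<open>A\<close>, and therefore acts
  on \<open>T \<rtimes> A\<close> through the first factor.\<close>
locale commuting_actions = A: group_with_action A T actA + Gal: group_with_action G T actG
  for A :: "('a, 'l) monoid_scheme" and T :: "('t, 'm) monoid_scheme" and actA
    and G :: "('g, 'k) monoid_scheme" and actG +
  assumes commute:
    "\<lbrakk>a \<in> carrier A; g \<in> carrier G; t \<in> carrier T\<rbrakk> \<Longrightarrow> actA a (actG g t) = actG g (actA a t)"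
begin

abbreviation E where "E \<equiv> semidirect T A actA"
abbreviation actE where "actE \<equiv> \<lambda>g (t, a). (actG g t, a)"

lemma E_simps [simp]:
  "p \<in> carrier E \<longleftrightarrow> fst p \<in> carrier T \<and> snd p \<in> carrier A"
  "p \<otimes>\<^bsub>E\<^esub> q = (fst p \<otimes>\<^bsub>T\<^esub> actA (snd p) (fst q), snd p \<otimes>\<^bsub>A\<^esub> snd q)"
  "\<one>\<^bsub>E\<^esub> = (\<one>\<^bsub>T\<^esub>, \<one>\<^bsub>A\<^esub>)"
  by (auto simp: semidirect_def mem_Times_iff case_prod_unfold)

lemma group_E: "group E"
proof (rule groupI)
  fix p assume p: "p \<in> carrier E"
  \<comment> \<open>The inverse of \<open>(t, a)\<close> is \<open>(a\<^sup>-\<^sup>1(t\<^sup>-\<^sup>1), a\<^sup>-\<^sup>1)\<close>.\<close>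
  let ?t = "fst p" and ?a = "snd p"
  have "actA (inv\<^bsub>A\<^esub> ?a) (inv\<^bsub>T\<^esub> ?t) \<otimes>\<^bsub>T\<^esub> actA (inv\<^bsub>A\<^esub> ?a) ?t = \<one>\<^bsub>T\<^esub>"
    using p by (simp add: A.act_distrib[symmetric] A.act_unit)
  then show "\<exists>q\<in>carrier E. q \<otimes>\<^bsub>E\<^esub> p = \<one>\<^bsub>E\<^esub>"
    using p by (intro bexI[of _ "(actA (inv\<^bsub>A\<^esub> ?a) (inv\<^bsub>T\<^esub> ?t), inv\<^bsub>A\<^esub> ?a)"]) auto
qed (simp_all add: A.act_distrib A.act_mult A.act_one A.coeff.m_assoc A.acting.m_assoc)

sublocale E: group_with_action G E actE
proof -
  interpret group E by (rule group_E)
  show "group_with_action G E actE"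
  proof unfold_locales
    fix g assume "g \<in> carrier G"
    then show "actE g \<in> hom E E" by (auto simp: hom_def Gal.act_distrib commute)
  qed (auto simp: Gal.act_mult Gal.act_one)
qed

sublocale triv: group_with_action G A trivial_act
  by unfold_locales (auto simp: trivial_act_def hom_def)

sublocale proj: equivariant_hom G E actE A trivial_act snd
  by unfold_locales (auto simp: trivial_act_def hom_def)

text \<open>For trivial action, the cocycle condition is the homomorphism condition and being cohomologous
  is conjugacy.\<close>
lemma ext_hom_eq_Z1: "ext_hom G A = Z1 G A trivial_act"
  unfolding ext_hom_def Z1_def hom_def trivial_act_def PiE_def by blast

lemma cohomologous_triv_iff:
  "(\<phi>, \<psi>) \<in> cohomologous G A trivial_act \<longleftrightarrow>
   \<phi> \<in> ext_hom G A \<and> \<psi> \<in> ext_hom G A \<and> conjugate_homs G A \<phi> \<psi>"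
  by (auto simp: cohomologous_def conjugate_homs_def ext_hom_eq_Z1 trivial_act_def)

text \<open>The action on \<open>T\<close> obtained by twisting with \<open>\<phi>\<close>: both \<open>g\<close> itself and \<open>\<phi> g\<close> are applied.\<close>
definition twisted_act where "twisted_act \<phi> g t = actA (\<phi> g) (actG g t)"

definition paired where "paired \<phi> t = (\<lambda>g\<in>carrier G. (t g, \<phi> g))"

definition fiber_class where "fiber_class \<phi> Q = (\<Union>C\<in>Q. \<Union>t\<in>C. H1_class G E actE (paired \<phi> t))"

text \<open>The map on \<open>H\<^sup>1\<close> induced by the splitting \<open>a \<mapsto> (1, a)\<close> of the projection.\<close>
definition split_class where "split_class C = (\<Union>\<phi>\<in>C. H1_class G E actE (paired \<phi> (\<lambda>_. \<one>\<^bsub>T\<^esub>)))"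

definition hom_centralizer where "hom_centralizer \<phi> = A\<lparr>carrier := centralizer A (\<phi> ` carrier G)\<rparr>"

definition centralizer_action where "centralizer_action \<phi> a = (\<lambda>C \<in> H1 G T (twisted_act \<phi>). H1_map G T (twisted_act \<phi>) (actA a) C)"

abbreviation \<pi> where "\<pi> \<equiv> H1_map G A trivial_act snd"

lemma paired_components:
  assumes "c \<in> Z1 G E actE" 
  shows "paired (\<lambda>g\<in>carrier G. snd (c g)) (\<lambda>g\<in>carrier G. fst (c g)) = c"
  using assms by (auto simp: paired_def Z1_def PiE_iff extensional_def)

lemma paired_one: "paired \<phi> (\<lambda>_. \<one>\<^bsub>T\<^esub>) = paired \<phi> (\<lambda>g\<in>carrier G. \<one>\<^bsub>T\<^esub>)"
  by (auto simp: paired_def)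

context
  fixes \<phi> assumes \<phi>: "\<phi> \<in> ext_hom G A"
begin

lemma phi_closed [simp]: "g \<in> carrier G \<Longrightarrow> \<phi> g \<in> carrier A"
  using \<phi> by (auto simp: ext_hom_def hom_def)

lemma phi_mult: "g \<in> carrier G \<Longrightarrow> h \<in> carrier G \<Longrightarrow> \<phi> (g \<otimes>\<^bsub>G\<^esub> h) = \<phi> g \<otimes>\<^bsub>A\<^esub> \<phi> h"
  using \<phi> by (auto simp: ext_hom_def hom_def)

lemma phi_one: "\<phi> \<one>\<^bsub>G\<^esub> = \<one>\<^bsub>A\<^esub>"
proof -
  interpret group_hom G A \<phi>
    using \<phi> by unfold_locales (auto simp: ext_hom_def)
  show ?thesis by (rule hom_one)
qed

lemma twisted_action: "group_with_action G T (twisted_act \<phi>)"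
  by unfold_locales
    (auto simp: twisted_act_def hom_def A.act_distrib Gal.act_distrib Gal.act_mult A.act_mult phi_mult
      phi_one commute A.act_one Gal.act_one)

text \<open>In \<open>T \<rtimes> A\<close>, the first component of \<open>(t\<^sub>g, \<phi>\<^sub>g) \<cdot> \<^sup>g(t\<^sub>h, \<phi>\<^sub>h)\<close> is \<open>t\<^sub>g \<cdot> \<phi>\<^sub>g(\<^sup>gt\<^sub>h)\<close>: the cocycle condition for
  the pair is the cocycle condition for \<open>t\<close> under the twisted action.\<close>
lemma paired_in_Z1_iff:
  assumes "t \<in> extensional (carrier G)"
  shows "paired \<phi> t \<in> Z1 G E actE \<longleftrightarrow> t \<in> Z1 G T (twisted_act \<phi>)"
proof -
  have "paired \<phi> t \<in> Z1 G E actE \<longleftrightarrow> (\<forall>g\<in>carrier G. t g \<in> carrier T) \<and>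
    (\<forall>g\<in>carrier G. \<forall>h\<in>carrier G. t (g \<otimes>\<^bsub>G\<^esub> h) = t g \<otimes>\<^bsub>T\<^esub> actA (\<phi> g) (actG g (t h)))"
    by (auto simp: Z1_def paired_def PiE_iff phi_mult)
  then show ?thesis using assms by (auto simp: Z1_def PiE_iff twisted_act_def)
qed

lemma paired_in_Z1: "t \<in> Z1 G T (twisted_act \<phi>) \<Longrightarrow> paired \<phi> t \<in> Z1 G E actE"
  using paired_in_Z1_iff[of t] by (auto simp: Z1_def PiE_def)

lemma proj_paired:
  assumes "t \<in> Z1 G T (twisted_act \<phi>)"
  shows "\<pi> (H1_class G E actE (paired \<phi> t)) = H1_class G A trivial_act \<phi>"
proof -
  have "(\<lambda>g\<in>carrier G. snd (paired \<phi> t g)) = \<phi>"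
    using \<phi> by (auto simp: paired_def ext_hom_def extensional_def)
  then show ?thesis using proj.H1_map_class[OF paired_in_Z1[OF assms]] by simp
qed

lemma one_in_Z1: "(\<lambda>g\<in>carrier G. \<one>\<^bsub>T\<^esub>) \<in> Z1 G T (twisted_act \<phi>)"
  by (auto simp: Z1_def twisted_act_def A.act_unit Gal.act_unit)

lemma H0_conjugation:
  "H0 G A (\<lambda>g a. \<phi> g \<otimes>\<^bsub>A\<^esub> a \<otimes>\<^bsub>A\<^esub> inv\<^bsub>A\<^esub> (\<phi> g)) = centralizer A (\<phi> ` carrier G)"
proof -
  have "\<phi> g \<otimes>\<^bsub>A\<^esub> a \<otimes>\<^bsub>A\<^esub> inv\<^bsub>A\<^esub> (\<phi> g) = a \<longleftrightarrow> a \<otimes>\<^bsub>A\<^esub> \<phi> g = \<phi> g \<otimes>\<^bsub>A\<^esub> a"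
    if "g \<in> carrier G" "a \<in> carrier A" for g a
    using that by (metis A.acting.inv_solve_right phi_closed A.acting.m_closed)
  then show ?thesis by (auto simp: H0_def centralizer_def)
qed

lemma subgroup_centralizer: "subgroup (centralizer A (\<phi> ` carrier G)) A"
proof (rule A.acting.subgroupI)
  show "centralizer A (\<phi> ` carrier G) \<subseteq> carrier A" by (auto simp: centralizer_def)
  have "\<one>\<^bsub>A\<^esub> \<in> centralizer A (\<phi> ` carrier G)" by (auto simp: centralizer_def)
  then show "centralizer A (\<phi> ` carrier G) \<noteq> {}" by blast
next
  fix a assume a: "a \<in> centralizer A (\<phi> ` carrier G)"
  have "inv\<^bsub>A\<^esub> a \<otimes>\<^bsub>A\<^esub> \<phi> g = \<phi> g \<otimes>\<^bsub>A\<^esub> inv\<^bsub>A\<^esub> a" if g: "g \<in> carrier G" for g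
  proof -
    have c: "a \<in> carrier A" "a \<otimes>\<^bsub>A\<^esub> \<phi> g = \<phi> g \<otimes>\<^bsub>A\<^esub> a" using a g by (auto simp: centralizer_def)
    have "inv\<^bsub>A\<^esub> a \<otimes>\<^bsub>A\<^esub> \<phi> g = inv\<^bsub>A\<^esub> a \<otimes>\<^bsub>A\<^esub> (\<phi> g \<otimes>\<^bsub>A\<^esub> a) \<otimes>\<^bsub>A\<^esub> inv\<^bsub>A\<^esub> a"
      using c(1) g by (simp add: A.acting.m_assoc)
    also have "\<dots> = \<phi> g \<otimes>\<^bsub>A\<^esub> inv\<^bsub>A\<^esub> a"
      using c(1) g by (simp add: c(2)[symmetric] A.acting.m_assoc[symmetric])
    finally show ?thesis .
  qed
  with a show "inv\<^bsub>A\<^esub> a \<in> centralizer A (\<phi> ` carrier G)" by (auto simp: centralizer_def)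
next
  fix a b assume ab: "a \<in> centralizer A (\<phi> ` carrier G)" "b \<in> centralizer A (\<phi> ` carrier G)"
  have "a \<otimes>\<^bsub>A\<^esub> b \<otimes>\<^bsub>A\<^esub> \<phi> g = \<phi> g \<otimes>\<^bsub>A\<^esub> (a \<otimes>\<^bsub>A\<^esub> b)" if g: "g \<in> carrier G" for g
  proof -
    have c: "a \<in> carrier A" "a \<otimes>\<^bsub>A\<^esub> \<phi> g = \<phi> g \<otimes>\<^bsub>A\<^esub> a" "b \<in> carrier A" "b \<otimes>\<^bsub>A\<^esub> \<phi> g = \<phi> g \<otimes>\<^bsub>A\<^esub> b" 
      using ab g by (auto simp: centralizer_def)
    have "a \<otimes>\<^bsub>A\<^esub> b \<otimes>\<^bsub>A\<^esub> \<phi> g = a \<otimes>\<^bsub>A\<^esub> \<phi> g \<otimes>\<^bsub>A\<^esub> b" using c g by (metis A.acting.m_assoc phi_closed)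
    also have "\<dots> = \<phi> g \<otimes>\<^bsub>A\<^esub> (a \<otimes>\<^bsub>A\<^esub> b)" using c g by (metis A.acting.m_assoc phi_closed)
    finally show ?thesis .
  qed
  with ab show "a \<otimes>\<^bsub>A\<^esub> b \<in> centralizer A (\<phi> ` carrier G)" by (auto simp: centralizer_def)
qed

lemma group_hom_centralizer: "group (hom_centralizer \<phi>)"
  unfolding hom_centralizer_def by (rule A.acting.subgroup_imp_group[OF subgroup_centralizer])

lemma centralizer_simps [simp]: "x \<otimes>\<^bsub>hom_centralizer \<phi>\<^esub> y = x \<otimes>\<^bsub>A\<^esub> y" "\<one>\<^bsub>hom_centralizer \<phi>\<^esub> = \<one>\<^bsub>A\<^esub>"
  by (simp_all add: hom_centralizer_def)

lemma centralizer_closed: "a \<in> carrier (hom_centralizer \<phi>) \<Longrightarrow> a \<in> carrier A"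
  by (simp add: hom_centralizer_def centralizer_def)

lemma centralizer_commutes: "a \<in> carrier (hom_centralizer \<phi>) \<Longrightarrow> g \<in> carrier G \<Longrightarrow> a \<otimes>\<^bsub>A\<^esub> \<phi> g = \<phi> g \<otimes>\<^bsub>A\<^esub> a"
  by (auto simp add: hom_centralizer_def centralizer_def)

text \<open>An element commuting with all \<open>\<phi>\<^sub>g\<close> commutes with the twisted action, so it acts on
  \<open>H\<^sup>1(G, T\<^sub>\<phi>)\<close>.\<close>
lemma centralizer_equivariant:
  assumes a: "a \<in> carrier (hom_centralizer \<phi>)"
  shows "equivariant_hom G T (twisted_act \<phi>) T (twisted_act \<phi>) (actA a)"
proof -
  interpret tw: group_with_action G T "twisted_act \<phi>" by (rule twisted_action)
  show ?thesis
  proof unfold_locales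
    show "actA a \<in> hom T T" by (rule A.act_hom[OF centralizer_closed[OF a]])
    fix g t assume gt: "g \<in> carrier G" "t \<in> carrier T"
    have "actA a (twisted_act \<phi> g t) = actA (a \<otimes>\<^bsub>A\<^esub> \<phi> g) (actG g t)"
      using gt centralizer_closed[OF a] by (simp add: twisted_act_def A.act_mult)
    also have "\<dots> = twisted_act \<phi> g (actA a t)"
      using gt centralizer_closed[OF a] by (simp add: twisted_act_def A.act_mult centralizer_commutes[OF a] commute)
    finally show "actA a (twisted_act \<phi> g t) = twisted_act \<phi> g (actA a t)" .
  qed
qed

lemma centralizer_action_class:
  assumes a: "a \<in> carrier (hom_centralizer \<phi>)" and t: "t \<in> Z1 G T (twisted_act \<phi>)"
  shows "centralizer_action \<phi> a (H1_class G T (twisted_act \<phi>) t) = H1_class G T (twisted_act \<phi>) (\<lambda>g\<in>carrier G. actA a (t g))"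
    and "(\<lambda>g\<in>carrier G. actA a (t g)) \<in> Z1 G T (twisted_act \<phi>)"
proof -
  interpret equivariant_hom G T "twisted_act \<phi>" T "twisted_act \<phi>" "actA a" by (rule centralizer_equivariant[OF a])
  show "centralizer_action \<phi> a (H1_class G T (twisted_act \<phi>) t) = H1_class G T (twisted_act \<phi>) (\<lambda>g\<in>carrier G. actA a (t g))"
    using S.H1_class_in_H1[OF t] H1_map_class[OF t] by (simp add: centralizer_action_def)
  show "(\<lambda>g\<in>carrier G. actA a (t g)) \<in> Z1 G T (twisted_act \<phi>)" by (rule Z1_image[OF t])
qed

lemma centralizer_group_action: "group_action (hom_centralizer \<phi>) (H1 G T (twisted_act \<phi>)) (centralizer_action \<phi>)"
proof -
  interpret tw: group_with_action G T "twisted_act \<phi>" by (rule twisted_action)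
  interpret C: group "hom_centralizer \<phi>" by (rule group_hom_centralizer)
  let ?H = "H1 G T (twisted_act \<phi>)"
  have closed: "centralizer_action \<phi> a C \<in> ?H" if "a \<in> carrier (hom_centralizer \<phi>)" "C \<in> ?H" for a C
    using that by (metis tw.H1E tw.H1_class_in_H1 centralizer_action_class)
  have mult: "centralizer_action \<phi> (a \<otimes>\<^bsub>A\<^esub> b) C = centralizer_action \<phi> a (centralizer_action \<phi> b C)"
    if a: "a \<in> carrier (hom_centralizer \<phi>)" and b: "b \<in> carrier (hom_centralizer \<phi>)" and C: "C \<in> ?H" for a b C
  proof -
    obtain t where t: "t \<in> Z1 G T (twisted_act \<phi>)" "C = H1_class G T (twisted_act \<phi>) t" using C by (rule tw.H1E)
    have "a \<otimes>\<^bsub>A\<^esub> b \<in> carrier (hom_centralizer \<phi>)" using C.m_closed[OF a b] by simp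
    moreover have "(\<lambda>g\<in>carrier G. actA (a \<otimes>\<^bsub>A\<^esub> b) (t g)) =
        (\<lambda>g\<in>carrier G. actA a ((\<lambda>g\<in>carrier G. actA b (t g)) g))"
      using centralizer_closed[OF a] centralizer_closed[OF b] tw.Z1_closed[OF t(1)]
      by (auto simp: A.act_mult)
    ultimately show ?thesis
      using t(2) centralizer_action_class[OF _ t(1)] centralizer_action_class[OF a centralizer_action_class(2)[OF b t(1)]] b by simp
  qed
  have one: "centralizer_action \<phi> \<one>\<^bsub>A\<^esub> C = C" if C: "C \<in> ?H" for C
  proof -
    obtain t where t: "t \<in> Z1 G T (twisted_act \<phi>)" "C = H1_class G T (twisted_act \<phi>) t" using C by (rule tw.H1E)
    have "(\<lambda>g\<in>carrier G. actA \<one>\<^bsub>A\<^esub> (t g)) = t"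
      using t(1) by (auto simp: Z1_def A.act_one PiE_iff extensional_def)
    then show ?thesis using t centralizer_action_class(1)[OF C.one_closed t(1)] by simp
  qed
  have bij: "centralizer_action \<phi> a \<in> Bij ?H" if a: "a \<in> carrier (hom_centralizer \<phi>)" for a
  proof -
    define a' where "a' = inv\<^bsub>hom_centralizer \<phi>\<^esub> a"
    have a': "a' \<in> carrier (hom_centralizer \<phi>)" "a' \<otimes>\<^bsub>A\<^esub> a = \<one>\<^bsub>A\<^esub>" "a \<otimes>\<^bsub>A\<^esub> a' = \<one>\<^bsub>A\<^esub>"
      using C.inv_closed[OF a] C.l_inv[OF a] C.r_inv[OF a] by (simp_all add: a'_def)
    have "bij_betw (centralizer_action \<phi> a) ?H ?H"
      by (rule bij_betw_byWitness[of _ "centralizer_action \<phi> a'"])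
        (use a a' closed one in \<open>auto simp: mult[symmetric]\<close>)
    then show ?thesis by (simp add: Bij_def centralizer_action_def)
  qed
  show ?thesis
    unfolding group_action_def group_hom_def group_hom_axioms_def
  proof (intro conjI group_hom_centralizer group_BijGroup homI)
    fix a b assume ab: "a \<in> carrier (hom_centralizer \<phi>)" "b \<in> carrier (hom_centralizer \<phi>)"
    show "centralizer_action \<phi> a \<in> carrier (BijGroup ?H)" using bij[OF ab(1)] by (simp add: BijGroup_def)
    have "centralizer_action \<phi> (a \<otimes>\<^bsub>A\<^esub> b) = compose ?H (centralizer_action \<phi> a) (centralizer_action \<phi> b)"
      by (rule extensionalityI[of _ ?H]) (auto simp: compose_def mult ab, simp add: centralizer_action_def)
    then show "centralizer_action \<phi> (a \<otimes>\<^bsub>hom_centralizer \<phi>\<^esub> b) = centralizer_action \<phi> a \<otimes>\<^bsub>BijGroup ?H\<^esub> centralizer_action \<phi> b"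
      using bij ab by (simp add: BijGroup_def)
  qed
qed

text \<open>The heart of the matter. A coboundary by \<open>(s, a)\<close> relates the cocycles \<open>(t\<^sub>g, \<phi>\<^sub>g)\<close> and \<open>(t'\<^sub>g, \<phi>\<^sub>g)\<close>
  precisely when \<open>a \<phi>\<^sub>g = \<phi>\<^sub>g a\<close> and \<open>s \<cdot> a(t'\<^sub>g) = t\<^sub>g \<cdot> \<phi>\<^sub>g(\<^sup>gs)\<close>. The second components say that \<open>a\<close> is in the
  centralizer, the first that \<open>t\<close> is cohomologous to the translate of \<open>t'\<close> by \<open>a\<close>.\<close>
lemma paired_class_eq_iff:
  assumes t: "t \<in> Z1 G T (twisted_act \<phi>)" and t': "t' \<in> Z1 G T (twisted_act \<phi>)"
  shows "H1_class G E actE (paired \<phi> t) = H1_class G E actE (paired \<phi> t') \<longleftrightarrow>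
    H1_class G T (twisted_act \<phi>) t \<in> orbit (hom_centralizer \<phi>) (centralizer_action \<phi>) (H1_class G T (twisted_act \<phi>) t')"
proof -
  interpret tw: group_with_action G T "twisted_act \<phi>" by (rule twisted_action)
  have "H1_class G E actE (paired \<phi> t) = H1_class G E actE (paired \<phi> t') \<longleftrightarrow>
    (\<exists>s\<in>carrier T. \<exists>a\<in>carrier A. \<forall>g\<in>carrier G.
       s \<otimes>\<^bsub>T\<^esub> actA a (t' g) = t g \<otimes>\<^bsub>T\<^esub> twisted_act \<phi> g s \<and> a \<otimes>\<^bsub>A\<^esub> \<phi> g = \<phi> g \<otimes>\<^bsub>A\<^esub> a)"
    unfolding E.H1_class_eq_iff[OF paired_in_Z1[OF t] paired_in_Z1[OF t']]
      E.cohomologous_iff[OF paired_in_Z1[OF t] paired_in_Z1[OF t']]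
    by (auto simp: paired_def twisted_act_def Bex_def)
  also have "\<dots> \<longleftrightarrow> (\<exists>a\<in>carrier (hom_centralizer \<phi>). \<exists>s\<in>carrier T. \<forall>g\<in>carrier G.
       s \<otimes>\<^bsub>T\<^esub> actA a (t' g) = t g \<otimes>\<^bsub>T\<^esub> twisted_act \<phi> g s)"
    by (auto simp: hom_centralizer_def centralizer_def)
  also have "\<dots> \<longleftrightarrow> (\<exists>a\<in>carrier (hom_centralizer \<phi>). H1_class G T (twisted_act \<phi>) t = centralizer_action \<phi> a (H1_class G T (twisted_act \<phi>) t'))"
    by (intro bex_cong refl)
      (simp add: centralizer_action_class t' tw.H1_class_eq_iff[OF t] tw.cohomologous_iff[OF t])
  also have "\<dots> \<longleftrightarrow> H1_class G T (twisted_act \<phi>) t \<in> orbit (hom_centralizer \<phi>) (centralizer_action \<phi>) (H1_class G T (twisted_act \<phi>) t')"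
    by (auto simp: orbit_def)
  finally show ?thesis .
qed

text \<open>All cocycles in all classes of an orbit have the same image, so the union defining the fiber
  map is a single class.\<close>
lemma fiber_class_orbit:
  assumes t: "t \<in> Z1 G T (twisted_act \<phi>)"
  shows "fiber_class \<phi> (orbit (hom_centralizer \<phi>) (centralizer_action \<phi>) (H1_class G T (twisted_act \<phi>) t)) = H1_class G E actE (paired \<phi> t)"
proof -
  interpret tw: group_with_action G T "twisted_act \<phi>" by (rule twisted_action)
  interpret act: group_action "hom_centralizer \<phi>" "H1 G T (twisted_act \<phi>)" "centralizer_action \<phi>" by (rule centralizer_group_action)
  let ?Q = "orbit (hom_centralizer \<phi>) (centralizer_action \<phi>) (H1_class G T (twisted_act \<phi>) t)"
  have "H1_class G E actE (paired \<phi> u) = H1_class G E actE (paired \<phi> t)" if C: "C \<in> ?Q" and u: "u \<in> C" for C u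
  proof -
    have "C \<in> H1 G T (twisted_act \<phi>)"
      using C act.element_image tw.H1_class_in_H1[OF t] by (auto simp: orbit_def)
    then obtain v where v: "v \<in> Z1 G T (twisted_act \<phi>)" "C = H1_class G T (twisted_act \<phi>) v" by (rule tw.H1E)
    then have vu: "(v, u) \<in> cohomologous G T (twisted_act \<phi>)" using u by (simp add: H1_class_def)
    then have "u \<in> Z1 G T (twisted_act \<phi>)" by (simp add: cohomologous_def)
    moreover have "C = H1_class G T (twisted_act \<phi>) u" using v vu calculation tw.H1_class_eq_iff by simp
    ultimately show ?thesis using paired_class_eq_iff[OF _ t] C by simp
  qed
  moreover have "H1_class G T (twisted_act \<phi>) t \<in> ?Q" "t \<in> H1_class G T (twisted_act \<phi>) t"
    using act.orbit_refl tw.H1_class_in_H1 tw.H1_class_self t by auto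
  ultimately show ?thesis unfolding fiber_class_def by blast
qed

text \<open>Injectivity is \<open>paired_class_eq_iff\<close> read in terms of orbits. For surjectivity, a
  class over \<open>[\<phi>]\<close> has a representative whose second component is conjugate to \<open>\<phi>\<close> by some \<open>a\<close>;
  the coboundary by \<open>(1, a)\<close> makes the second component equal to \<open>\<phi>\<close>.\<close>
lemma bij_betw_fiber_class:
  "bij_betw (fiber_class \<phi>) (orbits (hom_centralizer \<phi>) (H1 G T (twisted_act \<phi>)) (centralizer_action \<phi>))
     {C \<in> H1 G E actE. \<pi> C = H1_class G A trivial_act \<phi>}"
proof -
  interpret tw: group_with_action G T "twisted_act \<phi>" by (rule twisted_action)
  interpret act: group_action "hom_centralizer \<phi>" "H1 G T (twisted_act \<phi>)" "centralizer_action \<phi>" by (rule centralizer_group_action)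
  let ?orb = "\<lambda>t. orbit (hom_centralizer \<phi>) (centralizer_action \<phi>) (H1_class G T (twisted_act \<phi>) t)"
  have orbE: "\<exists>t\<in>Z1 G T (twisted_act \<phi>). Q = ?orb t" if "Q \<in> orbits (hom_centralizer \<phi>) (H1 G T (twisted_act \<phi>)) (centralizer_action \<phi>)" for Q
    using that by (auto simp: orbits_def elim: tw.H1E)
  have orbI: "?orb t \<in> orbits (hom_centralizer \<phi>) (H1 G T (twisted_act \<phi>)) (centralizer_action \<phi>)" if "t \<in> Z1 G T (twisted_act \<phi>)" for t
    using tw.H1_class_in_H1[OF that] by (auto simp: orbits_def)
  show ?thesis
  proof (rule bij_betw_imageI)
    show "inj_on (fiber_class \<phi>) (orbits (hom_centralizer \<phi>) (H1 G T (twisted_act \<phi>)) (centralizer_action \<phi>))"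
    proof (rule inj_onI)
      fix Q Q' assume Q: "Q \<in> orbits (hom_centralizer \<phi>) (H1 G T (twisted_act \<phi>)) (centralizer_action \<phi>)"
        and Q': "Q' \<in> orbits (hom_centralizer \<phi>) (H1 G T (twisted_act \<phi>)) (centralizer_action \<phi>)" and eq: "fiber_class \<phi> Q = fiber_class \<phi> Q'"
      obtain t t' where t: "t \<in> Z1 G T (twisted_act \<phi>)" "Q = ?orb t" and t': "t' \<in> Z1 G T (twisted_act \<phi>)" "Q' = ?orb t'"
        using orbE Q Q' by blast
      have "H1_class G T (twisted_act \<phi>) t \<in> Q \<inter> Q'"
        using eq t t' paired_class_eq_iff[OF t(1) t'(1)] act.orbit_refl tw.H1_class_in_H1
        by (simp add: fiber_class_orbit)
      then show "Q = Q'" using act.disjoint_union[OF Q Q'] by blast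
    qed
    show "fiber_class \<phi> ` orbits (hom_centralizer \<phi>) (H1 G T (twisted_act \<phi>)) (centralizer_action \<phi>) =
        {C \<in> H1 G E actE. \<pi> C = H1_class G A trivial_act \<phi>}"
    proof (intro subset_antisym subsetI)
      fix C assume "C \<in> fiber_class \<phi> ` orbits (hom_centralizer \<phi>) (H1 G T (twisted_act \<phi>)) (centralizer_action \<phi>)"
      then obtain t where "t \<in> Z1 G T (twisted_act \<phi>)" "C = H1_class G E actE (paired \<phi> t)"
        using orbE fiber_class_orbit by blast
      then show "C \<in> {C \<in> H1 G E actE. \<pi> C = H1_class G A trivial_act \<phi>}"
        using proj_paired E.H1_class_in_H1[OF paired_in_Z1] by simp
    next
      fix C assume "C \<in> {C \<in> H1 G E actE. \<pi> C = H1_class G A trivial_act \<phi>}"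
      then have C: "C \<in> H1 G E actE" "\<pi> C = H1_class G A trivial_act \<phi>" by auto
      obtain c where c: "c \<in> Z1 G E actE" "C = H1_class G E actE c" using C(1) by (rule E.H1E)
      let ?p = "\<lambda>g\<in>carrier G. snd (c g)"
      have "H1_class G A trivial_act ?p = H1_class G A trivial_act \<phi>"
        using C(2) c(2) proj.H1_map_class[OF c(1)] by simp
      then have "(?p, \<phi>) \<in> cohomologous G A trivial_act"
        using triv.H1_class_eq_iff proj.Z1_image[OF c(1)] \<phi> by (simp add: ext_hom_eq_Z1)
      then obtain a where a: "a \<in> carrier A"
        "\<And>g. g \<in> carrier G \<Longrightarrow> a \<otimes>\<^bsub>A\<^esub> \<phi> g = snd (c g) \<otimes>\<^bsub>A\<^esub> a"
        using triv.cohomologous_iff[OF proj.Z1_image[OF c(1)]] \<phi>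
        by (auto simp: ext_hom_eq_Z1 trivial_act_def)
      let ?b = "(\<one>\<^bsub>T\<^esub>, a)"
      define d where "d = (\<lambda>g\<in>carrier G. inv\<^bsub>E\<^esub> ?b \<otimes>\<^bsub>E\<^esub> c g \<otimes>\<^bsub>E\<^esub> actE g ?b)"
      have b: "?b \<in> carrier E" using a by simp
      have d: "d \<in> Z1 G E actE" "C = H1_class G E actE d"
        using E.Z1_coboundary_twist[OF c(1) b] c E.H1_class_eq_iff by (simp_all add: d_def)
      have "snd (d g) = \<phi> g" if g: "g \<in> carrier G" for g
      proof -
        have "?b \<otimes>\<^bsub>E\<^esub> d g = c g \<otimes>\<^bsub>E\<^esub> actE g ?b"
          unfolding d_def using g b E.Z1_closed[OF c(1) g] E.act_closed[OF g b]
          by (simp add: E.coeff.m_assoc[symmetric] del: E_simps case_prod_conv)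
        then have "a \<otimes>\<^bsub>A\<^esub> snd (d g) = snd (c g) \<otimes>\<^bsub>A\<^esub> a"
          by (cases "d g"; cases "c g") simp
        then show ?thesis
          using a g E.Z1_closed[OF d(1) g] by (metis A.acting.l_cancel E_simps(1) phi_closed)
      qed
      then have "(\<lambda>g\<in>carrier G. snd (d g)) = \<phi>"
        using \<phi> by (auto simp: ext_hom_def extensional_def)
      then have "paired \<phi> (\<lambda>g\<in>carrier G. fst (d g)) = d"
        using paired_components[OF d(1)] by simp
      moreover from this have "(\<lambda>g\<in>carrier G. fst (d g)) \<in> Z1 G T (twisted_act \<phi>)"
        using paired_in_Z1_iff[of "\<lambda>g\<in>carrier G. fst (d g)"] d(1) by simp
      ultimately show "C \<in> fiber_class \<phi> ` orbits (hom_centralizer \<phi>) (H1 G T (twisted_act \<phi>)) (centralizer_action \<phi>)"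
        using fiber_class_orbit d(2) orbI by (metis image_eqI)
    qed
  qed
qed

end

text \<open>If \<open>a\<close> conjugates \<open>\<phi>\<close> to \<open>\<psi>\<close>, then \<open>(1, a)\<close> relates \<open>(1, \<phi>)\<close> to \<open>(1, \<psi>)\<close>, because both actions fix
  the unit of \<open>T\<close>.\<close>
lemma split_class_of_hom:
  assumes \<phi>: "\<phi> \<in> ext_hom G A"
  shows "split_class (H1_class G A trivial_act \<phi>) = H1_class G E actE (paired \<phi> (\<lambda>_. \<one>\<^bsub>T\<^esub>))"
  unfolding split_class_def
proof (rule triv.UN_H1_class_const)
  show \<phi>Z: "\<phi> \<in> Z1 G A trivial_act" using \<phi> by (simp add: ext_hom_eq_Z1)
  fix \<psi> assume co: "(\<phi>, \<psi>) \<in> cohomologous G A trivial_act"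
  then have \<psi>Z: "\<psi> \<in> Z1 G A trivial_act" by (simp add: cohomologous_def)
  then have \<psi>: "\<psi> \<in> ext_hom G A" by (simp add: ext_hom_eq_Z1)
  obtain a where a: "a \<in> carrier A" "\<And>g. g \<in> carrier G \<Longrightarrow> a \<otimes>\<^bsub>A\<^esub> \<psi> g = \<phi> g \<otimes>\<^bsub>A\<^esub> a"
    using co triv.cohomologous_iff[OF \<phi>Z \<psi>Z] by (auto simp: trivial_act_def)
  have Z: "paired \<chi> (\<lambda>_. \<one>\<^bsub>T\<^esub>) \<in> Z1 G E actE" if "\<chi> \<in> ext_hom G A" for \<chi>
    using paired_in_Z1[OF that one_in_Z1[OF that]] by (simp add: paired_one)
  have "(paired \<phi> (\<lambda>_. \<one>\<^bsub>T\<^esub>), paired \<psi> (\<lambda>_. \<one>\<^bsub>T\<^esub>)) \<in> cohomologous G E actE"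
    unfolding E.cohomologous_iff[OF Z[OF \<phi>] Z[OF \<psi>]]
    using a phi_closed[OF \<phi>]
    by (intro bexI[of _ "(\<one>\<^bsub>T\<^esub>, a)"]) (auto simp: paired_def A.act_unit Gal.act_unit)
  then show "H1_class G E actE (paired \<psi> (\<lambda>_. \<one>\<^bsub>T\<^esub>)) = H1_class G E actE (paired \<phi> (\<lambda>_. \<one>\<^bsub>T\<^esub>))"
    using E.H1_class_eq_iff[OF Z[OF \<phi>] Z[OF \<psi>]] by simp
qed

lemma paired_one_in_Z1: "\<phi> \<in> ext_hom G A \<Longrightarrow> paired \<phi> (\<lambda>_. \<one>\<^bsub>T\<^esub>) \<in> Z1 G E actE"
  using paired_in_Z1[OF _ one_in_Z1] by (simp add: paired_one)

lemma proj_split_class: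
  assumes "C \<in> H1 G A trivial_act"
  shows "split_class C \<in> H1 G E actE" and "\<pi> (split_class C) = C"
proof -
  obtain \<phi> where "\<phi> \<in> Z1 G A trivial_act" "C = H1_class G A trivial_act \<phi>"
    using assms by (rule triv.H1E)
  then have \<phi>: "\<phi> \<in> ext_hom G A" "C = H1_class G A trivial_act \<phi>" by (simp_all add: ext_hom_eq_Z1)
  show "split_class C \<in> H1 G E actE"
    using \<phi> by (simp add: split_class_of_hom E.H1_class_in_H1 paired_one_in_Z1)
  show "\<pi> (split_class C) = C"
    using \<phi> proj_paired[OF \<phi>(1) one_in_Z1[OF \<phi>(1)]] by (simp add: split_class_of_hom paired_one)
qed

lemma proj_closed: "C \<in> H1 G E actE \<Longrightarrow> \<pi> C \<in> H1 G A trivial_act"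
  by (metis E.H1E proj.H1_map_class proj.Z1_image triv.H1_class_in_H1)

lemma proj_surj: "\<pi> ` H1 G E actE = H1 G A trivial_act"
proof (intro subset_antisym image_subsetI subsetI)
  fix C assume C: "C \<in> H1 G A trivial_act"
  show "C \<in> \<pi> ` H1 G E actE"
    using proj_split_class[OF C] by (metis imageI)
qed (rule proj_closed)

text \<open>The fibers of the projection partition the source, and representatives of the conjugacy
  classes of homomorphisms enumerate the points of the target without repetition.\<close>
lemma bij_betw_partition:
  assumes R: "hom_class_reps G A R"
  shows "bij_betw (\<lambda>(\<phi>, Q). fiber_class \<phi> Q)
    (SIGMA \<phi>:R. orbits (hom_centralizer \<phi>) (H1 G T (twisted_act \<phi>)) (centralizer_action \<phi>)) (H1 G E actE)"
proof (rule bij_betw_imageI)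
  have RE: "\<phi> \<in> ext_hom G A" if "\<phi> \<in> R" for \<phi> using R that by (auto simp: hom_class_reps_def)
  have class_iff: "H1_class G A trivial_act \<phi> = H1_class G A trivial_act \<psi> \<longleftrightarrow> conjugate_homs G A \<phi> \<psi>"
    if "\<phi> \<in> ext_hom G A" "\<psi> \<in> ext_hom G A" for \<phi> \<psi>
    using that triv.H1_class_eq_iff[of \<phi> \<psi>] cohomologous_triv_iff[of \<phi> \<psi>] by (simp add: ext_hom_eq_Z1)
  show "inj_on (\<lambda>(\<phi>, Q). fiber_class \<phi> Q) (SIGMA \<phi>:R. orbits (hom_centralizer \<phi>) (H1 G T (twisted_act \<phi>)) (centralizer_action \<phi>))"
  proof (rule inj_onI, safe)
    fix \<phi> Q \<psi> Q' assume \<phi>: "\<phi> \<in> R" "Q \<in> orbits (hom_centralizer \<phi>) (H1 G T (twisted_act \<phi>)) (centralizer_action \<phi>)"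
      and \<psi>: "\<psi> \<in> R" "Q' \<in> orbits (hom_centralizer \<psi>) (H1 G T (twisted_act \<psi>)) (centralizer_action \<psi>)"
      and eq: "fiber_class \<phi> Q = fiber_class \<psi> Q'"
    have "H1_class G A trivial_act \<phi> = H1_class G A trivial_act \<psi>"
      using bij_betwE[OF bij_betw_fiber_class[OF RE[OF \<phi>(1)]]] bij_betwE[OF bij_betw_fiber_class[OF RE[OF \<psi>(1)]]]
        \<phi>(2) \<psi>(2) eq by auto
    then have "conjugate_homs G A \<phi> \<psi>" "conjugate_homs G A \<phi> \<phi>"
      using class_iff RE \<phi>(1) \<psi>(1) by auto
    then show 1: "\<phi> = \<psi>" using R RE[OF \<phi>(1)] \<phi>(1) \<psi>(1) unfolding hom_class_reps_def by blast
    show "x \<in> Q'" if "x \<in> Q" for x 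
      using that bij_betw_imp_inj_on[OF bij_betw_fiber_class[OF RE[OF \<phi>(1)]]] \<phi> \<psi> eq 1 by (auto dest: inj_onD)
    show "x \<in> Q" if "x \<in> Q'" for x 
      using that bij_betw_imp_inj_on[OF bij_betw_fiber_class[OF RE[OF \<phi>(1)]]] \<phi> \<psi> eq 1 by (auto dest: inj_onD)
  qed
  show "(\<lambda>(\<phi>, Q). fiber_class \<phi> Q) ` (SIGMA \<phi>:R. orbits (hom_centralizer \<phi>) (H1 G T (twisted_act \<phi>)) (centralizer_action \<phi>)) = H1 G E actE"
  proof (intro subset_antisym subsetI)
    fix C assume "C \<in> (\<lambda>(\<phi>, Q). fiber_class \<phi> Q) ` (SIGMA \<phi>:R. orbits (hom_centralizer \<phi>) (H1 G T (twisted_act \<phi>)) (centralizer_action \<phi>))"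
    then show "C \<in> H1 G E actE" using bij_betwE[OF bij_betw_fiber_class[OF RE]] by auto
  next
    fix C assume C: "C \<in> H1 G E actE"
    obtain \<psi> where \<psi>: "\<psi> \<in> ext_hom G A" "\<pi> C = H1_class G A trivial_act \<psi>"
      using proj_closed[OF C] by (auto simp: ext_hom_eq_Z1 elim: triv.H1E)
    obtain \<phi> where \<phi>: "\<phi> \<in> R" "conjugate_homs G A \<psi> \<phi>"
      using R \<psi>(1) unfolding hom_class_reps_def by blast
    then have "\<pi> C = H1_class G A trivial_act \<phi>" using \<psi> class_iff RE by simp
    then have "C \<in> fiber_class \<phi> ` orbits (hom_centralizer \<phi>) (H1 G T (twisted_act \<phi>)) (centralizer_action \<phi>)"
      using C bij_betw_imp_surj_on[OF bij_betw_fiber_class[OF RE[OF \<phi>(1)]]] by simp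
    then show "C \<in> (\<lambda>(\<phi>, Q). fiber_class \<phi> Q) ` (SIGMA \<phi>:R. orbits (hom_centralizer \<phi>) (H1 G T (twisted_act \<phi>)) (centralizer_action \<phi>))"
      using \<phi>(1) by force
  qed
qed

end

section \<open>Functoriality of the tensor product\<close>

text \<open>The lift of \<open>f \<otimes> h\<close> to the free abelian group on pairs, before passing to the quotient by the
  bilinearity relations.\<close>
abbreviation free_tensor_map ::
  "('a \<Rightarrow> 'a) \<Rightarrow> ('b \<Rightarrow> 'b) \<Rightarrow> ('a \<times> 'b \<Rightarrow>\<^sub>0 int) \<Rightarrow> ('a \<times> 'b \<Rightarrow>\<^sub>0 int)" where
  "free_tensor_map f h \<equiv> frag_extend (\<lambda>(a, b). frag_of (f a, h b))"

locale tensor_factors = A: monoid A + B: monoid B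
  for A :: "('a, 'm) monoid_scheme" and B :: "('b, 'l) monoid_scheme"
begin

abbreviation "F \<equiv> free_Abelian_group (carrier A \<times> carrier B)"
abbreviation "R \<equiv> tensor_relations A B"

lemma subgroup_tensor_relations: "subgroup R F"
  unfolding tensor_relations_def
proof (rule group.generate_is_subgroup[OF group_free_Abelian_group], safe)
  have diff: "c - d - e \<in> carrier F" if "c \<in> carrier F" "d \<in> carrier F" "e \<in> carrier F" for c d e
    using that keys_diff[of c d] keys_diff[of "c - d" e] by simp blast
  fix a a' b assume "a \<in> carrier A" "a' \<in> carrier A" "b \<in> carrier B"
  then show "frag_of (a \<otimes>\<^bsub>A\<^esub> a', b) - frag_of (a, b) - frag_of (a', b) \<in> carrier F"
    by (intro diff) auto
next
  have diff: "c - d - e \<in> carrier F" if "c \<in> carrier F" "d \<in> carrier F" "e \<in> carrier F" for c d e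
    using that keys_diff[of c d] keys_diff[of "c - d" e] by simp blast
  fix a b b' assume "a \<in> carrier A" "b \<in> carrier B" "b' \<in> carrier B"
  then show "frag_of (a, b \<otimes>\<^bsub>B\<^esub> b') - frag_of (a, b) - frag_of (a, b') \<in> carrier F"
    by (intro diff) auto
qed

sublocale tensor_relations: normal R F
  by (rule comm_group.subgroup_imp_normal[OF abelian_free_Abelian_group subgroup_tensor_relations])

lemma comm_group_tensor_group: "comm_group (tensor_group A B)"
  unfolding tensor_group_def
  by (rule comm_group.abelian_FactGroup[OF abelian_free_Abelian_group subgroup_tensor_relations])

lemma tensor_group_carrierE:
  assumes "C \<in> carrier (tensor_group A B)"
  obtains x where "x \<in> carrier F" "C = R #>\<^bsub>F\<^esub> x"
  using assms by (auto simp: tensor_group_def FactGroup_def RCOSETS_def simp del: carrier_free_Abelian_group_iff)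

lemma tensor_coset_closed: "x \<in> carrier F \<Longrightarrow> R #>\<^bsub>F\<^esub> x \<in> carrier (tensor_group A B)"
  by (auto simp: tensor_group_def FactGroup_def RCOSETS_def simp del: carrier_free_Abelian_group_iff)

lemma tensor_elem_closed:
  "a \<in> carrier A \<Longrightarrow> b \<in> carrier B \<Longrightarrow> tensor_elem A B a b \<in> carrier (tensor_group A B)"
  unfolding tensor_elem_def by (rule tensor_coset_closed) simp

lemma tensor_coset_mult:
  "x \<in> carrier F \<Longrightarrow> y \<in> carrier F \<Longrightarrow>
   (R #>\<^bsub>F\<^esub> x) \<otimes>\<^bsub>tensor_group A B\<^esub> (R #>\<^bsub>F\<^esub> y) = R #>\<^bsub>F\<^esub> (x + y)"
  using tensor_relations.rcos_sum[of x y] by (simp add: tensor_group_def FactGroup_def)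

lemma free_tensor_map_closed:
  assumes "f \<in> carrier A \<rightarrow> carrier A" "h \<in> carrier B \<rightarrow> carrier B" "x \<in> carrier F"
  shows "free_tensor_map f h x \<in> carrier F"
  using assms by (auto dest!: keys_frag_extend[THEN subsetD] split: prod.splits)

text \<open>The lift sends each generating relation to the relation of the same kind between the images,
  which is where additivity of \<open>f\<close> and \<open>h\<close> enters; hence it preserves the subgroup they generate.\<close>
lemma free_tensor_map_relations:
  assumes f: "f \<in> hom A A" and h: "h \<in> hom B B" and x: "x \<in> R"
  shows "free_tensor_map f h x \<in> R"
proof -
  let ?S = "{frag_of (a \<otimes>\<^bsub>A\<^esub> a', b) - frag_of (a, b) - frag_of (a', b) | a a' b.
           a \<in> carrier A \<and> a' \<in> carrier A \<and> b \<in> carrier B} \<union>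
        {frag_of (a, b \<otimes>\<^bsub>B\<^esub> b') - frag_of (a, b) - frag_of (a, b') | a b b'.
           a \<in> carrier A \<and> b \<in> carrier B \<and> b' \<in> carrier B}"
  have gen: "R = generate F ?S" by (rule tensor_relations_def)
  have S: "free_tensor_map f h y \<in> ?S" if "y \<in> ?S" for y
    using that
  proof
    assume "y \<in> {frag_of (a \<otimes>\<^bsub>A\<^esub> a', b) - frag_of (a, b) - frag_of (a', b) | a a' b.
           a \<in> carrier A \<and> a' \<in> carrier A \<and> b \<in> carrier B}"
    then obtain a a' b where y: "y = frag_of (a \<otimes>\<^bsub>A\<^esub> a', b) - frag_of (a, b) - frag_of (a', b)"
      and ab: "a \<in> carrier A" "a' \<in> carrier A" "b \<in> carrier B" by blast
    have "free_tensor_map f h y =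
        frag_of (f a \<otimes>\<^bsub>A\<^esub> f a', h b) - frag_of (f a, h b) - frag_of (f a', h b)"
      by (simp add: y frag_extend_diff hom_mult[OF f] ab)
    then show ?thesis using ab hom_in_carrier[OF f] hom_in_carrier[OF h] by blast
  next
    assume "y \<in> {frag_of (a, b \<otimes>\<^bsub>B\<^esub> b') - frag_of (a, b) - frag_of (a, b') | a b b'.
           a \<in> carrier A \<and> b \<in> carrier B \<and> b' \<in> carrier B}"
    then obtain a b b' where y: "y = frag_of (a, b \<otimes>\<^bsub>B\<^esub> b') - frag_of (a, b) - frag_of (a, b')"
      and ab: "a \<in> carrier A" "b \<in> carrier B" "b' \<in> carrier B" by blast
    have "free_tensor_map f h y =
        frag_of (f a, h b \<otimes>\<^bsub>B\<^esub> h b') - frag_of (f a, h b) - frag_of (f a, h b')"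
      by (simp add: y frag_extend_diff hom_mult[OF h] ab)
    then show ?thesis using ab hom_in_carrier[OF f] hom_in_carrier[OF h] by blast
  qed
  show ?thesis using x unfolding gen
  proof (induction rule: generate.induct)
    case one
    show ?case by (simp add: generate.one[of F, simplified])
  next
    case (incl y)
    show ?case by (rule generate.incl[OF S[OF incl]])
  next
    case (inv y)
    have R: "y \<in> R" "free_tensor_map f h y \<in> R"
      using generate.incl[OF inv] generate.incl[OF S[OF inv]] by (simp_all only: gen)
    have "inv\<^bsub>F\<^esub> y = - y" "inv\<^bsub>F\<^esub> (free_tensor_map f h y) = - free_tensor_map f h y"
      using R[THEN tensor_relations.mem_carrier] by simp_all
    with tensor_relations.m_inv_closed[OF R(2)] show ?case
      by (simp only: frag_extend_minus gen)
  next
    case (eng y z)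
    then show ?case
      using generate.eng[of "free_tensor_map f h y" F _ "free_tensor_map f h z"]
      by (simp add: frag_extend_add)
  qed
qed

text \<open>Two representatives of a coset differ by a relation, and so do their images; the union of
  cosets that defines \<^const>\<open>tensor_map\<close> is therefore a union of equal cosets.\<close>
lemma tensor_map_coset:
  assumes f: "f \<in> hom A A" and h: "h \<in> hom B B" and x: "x \<in> carrier F"
  shows "tensor_map A B f h (R #>\<^bsub>F\<^esub> x) = R #>\<^bsub>F\<^esub> free_tensor_map f h x"
proof -
  have "R #>\<^bsub>F\<^esub> free_tensor_map f h y = R #>\<^bsub>F\<^esub> free_tensor_map f h x" if y: "y \<in> R #>\<^bsub>F\<^esub> x" for y
  proof -
    obtain r where r: "r \<in> R" "y = r + x" using y by (auto simp: r_coset_def)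
    have "free_tensor_map f h y \<in> R #>\<^bsub>F\<^esub> free_tensor_map f h x"
      using free_tensor_map_relations[OF f h r(1)] r(2)
      by (auto simp: r_coset_def frag_extend_add)
    then show ?thesis
      using group.repr_independence[OF group_free_Abelian_group _ _ subgroup_tensor_relations]
        free_tensor_map_closed[OF _ _ x] f h by (metis hom_carrier image_subset_iff_funcset)
  qed
  moreover have "x \<in> R #>\<^bsub>F\<^esub> x"
    using group.rcos_self[OF group_free_Abelian_group x subgroup_tensor_relations] .
  ultimately show ?thesis unfolding tensor_map_def by blast
qed

lemma tensor_map_hom:
  assumes f: "f \<in> hom A A" and h: "h \<in> hom B B"
  shows "tensor_map A B f h \<in> hom (tensor_group A B) (tensor_group A B)"
proof (rule homI)
  have fh: "f \<in> carrier A \<rightarrow> carrier A" "h \<in> carrier B \<rightarrow> carrier B"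
    using f h by (auto simp: hom_def)
  fix C assume "C \<in> carrier (tensor_group A B)"
  then obtain x where x: "x \<in> carrier F" "C = R #>\<^bsub>F\<^esub> x" by (rule tensor_group_carrierE)
  then show "tensor_map A B f h C \<in> carrier (tensor_group A B)"
    using tensor_map_coset[OF f h] free_tensor_map_closed[OF fh] tensor_coset_closed by metis
  fix D assume "D \<in> carrier (tensor_group A B)"
  then obtain y where y: "y \<in> carrier F" "D = R #>\<^bsub>F\<^esub> y" by (rule tensor_group_carrierE)
  have "x + y \<in> carrier F" using x y monoid.m_closed[OF group.is_monoid[OF group_free_Abelian_group]]
    by (metis mult_free_Abelian_group)
  then show "tensor_map A B f h (C \<otimes>\<^bsub>tensor_group A B\<^esub> D) =
      tensor_map A B f h C \<otimes>\<^bsub>tensor_group A B\<^esub> tensor_map A B f h D"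
    using x y by (simp add: tensor_coset_mult tensor_map_coset[OF f h] free_tensor_map_closed[OF fh]
        frag_extend_add del: carrier_free_Abelian_group_iff)
qed

text \<open>The composites \<open>u\<close> and \<open>v\<close> are described by their values on the carriers, because products of
  automorphisms are formed by \<^const>\<open>compose\<close>, which has a default value elsewhere.\<close>
lemma tensor_map_comp:
  assumes "f \<in> hom A A" "h \<in> hom B B" "f' \<in> hom A A" "h' \<in> hom B B"
    and u: "\<And>a. a \<in> carrier A \<Longrightarrow> u a = f (f' a)" and v: "\<And>b. b \<in> carrier B \<Longrightarrow> v b = h (h' b)"
    and C: "C \<in> carrier (tensor_group A B)"
  shows "tensor_map A B u v C = tensor_map A B f h (tensor_map A B f' h' C)"
proof -
  obtain x where x: "x \<in> carrier F" "C = R #>\<^bsub>F\<^esub> x" using C by (rule tensor_group_carrierE)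
  have uv: "u \<in> hom A A" "v \<in> hom B B" using assms(1-4) u v by (auto simp: hom_def Pi_iff)
  have "free_tensor_map u v x = frag_extend (\<lambda>p. case p of (a, b) \<Rightarrow> frag_of (f (f' a), h (h' b))) x"
    using x u v by (intro frag_extend_eq) auto
  also have "\<dots> = free_tensor_map f h (free_tensor_map f' h' x)"
    using frag_extend_compose[of "\<lambda>(a, b). frag_of (f a, h b)" "\<lambda>(a, b). (f' a, h' b)" x]
    by (simp add: o_def case_prod_unfold)
  finally show ?thesis
    using x assms(1-4) uv free_tensor_map_closed[of f' h' x]
    by (simp add: tensor_map_coset hom_def del: carrier_free_Abelian_group_iff)
qed

lemma tensor_map_id:
  assumes u: "\<And>a. a \<in> carrier A \<Longrightarrow> u a = a" and v: "\<And>b. b \<in> carrier B \<Longrightarrow> v b = b"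
    and C: "C \<in> carrier (tensor_group A B)"
  shows "tensor_map A B u v C = C"
proof -
  obtain x where x: "x \<in> carrier F" "C = R #>\<^bsub>F\<^esub> x" using C by (rule tensor_group_carrierE)
  have uv: "u \<in> hom A A" "v \<in> hom B B" using u v by (auto simp: hom_def Pi_iff)
  have "free_tensor_map u v x = frag_extend frag_of x"
    using x u v by (intro frag_extend_eq) auto
  then show ?thesis using x uv by (simp add: tensor_map_coset frag_expansion[symmetric] del: carrier_free_Abelian_group_iff)
qed

end

section \<open>The groups acting on the torus\<close>

lemma subgroup_galois_group:
  assumes K: "ring K" and k: "k \<subseteq> carrier K"
  shows "subgroup {g \<in> ring_iso K K \<inter> extensional (carrier K). \<forall>x\<in>k. g x = x}
           (BijGroup (carrier K))"
    (is "subgroup ?S _")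
proof -
  interpret ring K by (rule K)
  interpret Bij: group "BijGroup (carrier K)" by (rule group_BijGroup)
  have bij: "g \<in> Bij (carrier K)" if "g \<in> ?S" for g
    using that by (auto simp: ring_iso_def Bij_def)
  show ?thesis
  proof (rule Bij.subgroupI)
    show "?S \<subseteq> carrier (BijGroup (carrier K))" using bij by (auto simp: BijGroup_def)
    have "(\<lambda>x\<in>carrier K. x) \<in> ?S"
      using k id_Bij[of "carrier K"] by (auto intro!: ring_iso_memI simp: Bij_def)
    then show "?S \<noteq> {}" by blast
  next
    fix g assume g: "g \<in> ?S"
    let ?i = "\<lambda>x\<in>carrier K. inv_into (carrier K) g x"
    have gb: "bij_betw g (carrier K) (carrier K)" and gh: "g \<in> ring_hom K K"
      using g by (auto simp: ring_iso_def)
    have gi: "g (?i x) = x" "?i x \<in> carrier K" if "x \<in> carrier K" for x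
      using that gb by (auto simp: bij_betw_inv_into_right bij_betw_def inv_into_into)
    have ig: "?i (g x) = x" if "x \<in> carrier K" for x
      using that gb by (auto simp: bij_betw_inv_into_left bij_betwE)
    have inj: "x = y" if "g x = g y" "x \<in> carrier K" "y \<in> carrier K" for x y
      using that gb by (auto simp: bij_betw_def dest: inj_onD)
    have "?i \<in> ring_iso K K"
    proof (rule ring_iso_memI)
      show "bij_betw ?i (carrier K) (carrier K)"
        using restrict_inv_into_Bij[OF bij[OF g]] by (simp add: Bij_def)
      show "?i \<one>\<^bsub>K\<^esub> = \<one>\<^bsub>K\<^esub>" using ig[of "\<one>\<^bsub>K\<^esub>"] ring_hom_one[OF gh] by simp
      fix x y assume xy: "x \<in> carrier K" "y \<in> carrier K"
      show "?i x \<in> carrier K" by (rule gi(2)[OF xy(1)])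
      show "?i (x \<otimes>\<^bsub>K\<^esub> y) = ?i x \<otimes>\<^bsub>K\<^esub> ?i y"
        by (rule inj) (simp_all only: xy gi ring_hom_mult[OF gh] m_closed)
      show "?i (x \<oplus>\<^bsub>K\<^esub> y) = ?i x \<oplus>\<^bsub>K\<^esub> ?i y"
        by (rule inj) (simp_all only: xy gi ring_hom_add[OF gh] a_closed)
    qed
    moreover have "?i x = x" if "x \<in> k" for x using that ig[of x] k g by auto
    ultimately have "?i \<in> ?S" by auto
    then show "inv\<^bsub>BijGroup (carrier K)\<^esub> g \<in> ?S" using inv_BijGroup[OF bij[OF g]] by simp
  next
    fix g h assume gh: "g \<in> ?S" "h \<in> ?S"
    then have hom: "g \<in> ring_hom K K" "h \<in> ring_hom K K" by (auto simp: ring_iso_def)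
    note cl = ring_hom_closed[OF hom(1)] ring_hom_closed[OF hom(2)]
    have "compose (carrier K) g h \<in> ring_iso K K"
      using compose_Bij[OF bij[OF gh(1)] bij[OF gh(2)]] cl hom
      by (intro ring_iso_memI)
        (auto simp: compose_def Bij_def ring_hom_mult ring_hom_add ring_hom_one)
    moreover have "compose (carrier K) g h x = x" if "x \<in> k" for x
      using that gh k by (auto simp: compose_def)
    ultimately show "g \<otimes>\<^bsub>BijGroup (carrier K)\<^esub> h \<in> ?S"
      using bij gh by (simp add: BijGroup_def)
  qed
qed

lemma group_galois_group:
  assumes "ring K" "k \<subseteq> carrier K"
  shows "group (galois_group K k)"
  unfolding galois_group_def
  by (rule subgroup.subgroup_is_group[OF subgroup_galois_group[OF assms] group_BijGroup])

lemma galois_group_mult: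
  assumes "g \<in> carrier (galois_group K k)" "h \<in> carrier (galois_group K k)"
  shows "g \<otimes>\<^bsub>galois_group K k\<^esub> h = compose (carrier K) g h"
  using assms by (auto simp: galois_group_def BijGroup_def ring_iso_def Bij_def)

lemma galois_group_one: "\<one>\<^bsub>galois_group K k\<^esub> = (\<lambda>x\<in>carrier K. x)"
  by (simp add: galois_group_def BijGroup_def)

text \<open>A ring automorphism carries the inverse of a unit to an inverse of its image, so it acts on
  \<open>K\<^sup>\<times>\<close>.\<close>
lemma galois_units_hom:
  assumes K: "ring K" and g: "g \<in> carrier (galois_group K k)"
  shows "g \<in> hom (units_of K) (units_of K)"
proof -
  interpret ring K by (rule K)
  have g: "g \<in> ring_hom K K" using g by (auto simp: galois_group_def ring_iso_def)
  have "g x \<in> Units K" if x: "x \<in> Units K" for x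
  proof -
    have "g (inv\<^bsub>K\<^esub> x) \<otimes>\<^bsub>K\<^esub> g x = \<one>\<^bsub>K\<^esub>" "g x \<otimes>\<^bsub>K\<^esub> g (inv\<^bsub>K\<^esub> x) = \<one>\<^bsub>K\<^esub>"
      using x Units_closed Units_inv_closed Units_l_inv Units_r_inv ring_hom_one[OF g] ring_hom_mult[OF g]
      by metis+
    moreover have "g x \<in> carrier K" "g (inv\<^bsub>K\<^esub> x) \<in> carrier K"
      using ring_hom_closed[OF g] Units_closed[OF x] Units_inv_closed[OF x] by auto
    ultimately show ?thesis unfolding Units_def by blast
  qed
  then show ?thesis
    by (intro homI) (simp_all add: units_of_carrier units_of_mult ring_hom_mult[OF g] Units_closed)
qed

lemma monoid_real_group: "monoid real_group"
  by (rule monoidI) (simp_all add: real_group_def)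

text \<open>The laws \<open>(ab)\<^sub>* = a\<^sub>* b\<^sub>*\<close> and \<open>1\<^sub>* = 1\<close> for the induced maps of \<open>N \<otimes> \<real>\<close> hold on its carrier, so
  they apply to a cone once its points are known to lie there.\<close>
lemma cone_subset:
  assumes N: "group N" and \<sigma>: "rational_cone N \<sigma>"
  shows "\<sigma> \<subseteq> carrier (lattice_real N)"
proof -
  interpret tensor_factors N real_group
    by (rule tensor_factors.intro[OF group.is_monoid[OF N] monoid_real_group])
  interpret L: comm_group "lattice_real N"
    unfolding lattice_real_def by (rule comm_group_tensor_group)
  have "finprod (lattice_real N) (\<lambda>v. tensor_elem N real_group v (r v)) S \<in> carrier (lattice_real N)"
    if "S \<subseteq> carrier N" for S r
    using that tensor_elem_closed by (intro L.finprod_closed) (auto simp: real_group_def lattice_real_def)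
  with \<sigma> show ?thesis by (auto simp: rational_cone_def)
qed

lemma auto_hom: "a \<in> auto N \<Longrightarrow> a \<in> hom N N" by (simp add: auto_def)

text \<open>By functoriality, \<open>Aut(N)\<close> acts on sets of subsets of \<open>N \<otimes> \<real>\<close>, and the automorphisms of a fan
  are a stabilizer for this action.\<close>
lemma subgroup_fan_aut:
  assumes N: "group N" and \<Sigma>: "\<And>\<sigma>. \<sigma> \<in> \<Sigma> \<Longrightarrow> \<sigma> \<subseteq> carrier (lattice_real N)"
  shows "subgroup {a \<in> auto N. (\<lambda>\<sigma>. tensor_map N real_group a id ` \<sigma>) ` \<Sigma> = \<Sigma>} (AutoGroup N)"
    (is "subgroup ?S _")
proof -
  interpret N: group N by (rule N)
  interpret tensor_factors N real_group
    by (rule tensor_factors.intro[OF N.is_monoid monoid_real_group])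
  interpret Aut: group "AutoGroup N" by (rule N.AutoGroup)
  define m where "m a = image (image (tensor_map N real_group a id))" for a
  have id: "id \<in> hom real_group real_group" by (auto simp: hom_def)
  have m_comp: "m (compose (carrier N) a b) \<Sigma>' = m a (m b \<Sigma>')"
    if "a \<in> auto N" "b \<in> auto N" "\<And>\<sigma>. \<sigma> \<in> \<Sigma>' \<Longrightarrow> \<sigma> \<subseteq> carrier (lattice_real N)" for a b \<Sigma>'
  proof -
    have "tensor_map N real_group (compose (carrier N) a b) id x =
        tensor_map N real_group a id (tensor_map N real_group b id x)"
      if "x \<in> carrier (lattice_real N)" for x
      using that auto_hom \<open>a \<in> auto N\<close> \<open>b \<in> auto N\<close>
      by (intro tensor_map_comp id) (auto simp: lattice_real_def compose_def)
    then have "tensor_map N real_group (compose (carrier N) a b) id ` \<sigma> =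
        tensor_map N real_group a id ` tensor_map N real_group b id ` \<sigma>" if "\<sigma> \<in> \<Sigma>'" for \<sigma>
      using that \<open>\<And>\<sigma>. \<sigma> \<in> \<Sigma>' \<Longrightarrow> \<sigma> \<subseteq> carrier (lattice_real N)\<close>
      unfolding image_image by (intro image_cong) auto
    then show ?thesis unfolding m_def image_image by (rule image_cong[OF refl])
  qed
  have m_one: "m (\<lambda>x\<in>carrier N. x) \<Sigma> = \<Sigma>"
  proof -
    have "tensor_map N real_group (\<lambda>x\<in>carrier N. x) id ` \<sigma> = \<sigma>" if "\<sigma> \<in> \<Sigma>" for \<sigma>
    proof -
      have "tensor_map N real_group (\<lambda>x\<in>carrier N. x) id ` \<sigma> = (\<lambda>x. x) ` \<sigma>"
        using \<Sigma>[OF that] by (intro image_cong tensor_map_id) (auto simp: lattice_real_def)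
      then show ?thesis by simp
    qed
    then have "m (\<lambda>x\<in>carrier N. x) \<Sigma> = (\<lambda>\<sigma>. \<sigma>) ` \<Sigma>"
      unfolding m_def by (rule image_cong[OF refl])
    then show ?thesis by simp
  qed
  have mult: "a \<otimes>\<^bsub>AutoGroup N\<^esub> b = compose (carrier N) a b" if "a \<in> auto N" "b \<in> auto N" for a b
    using that by (simp add: AutoGroup_def BijGroup_def auto_def)
  have S: "a \<in> ?S \<longleftrightarrow> a \<in> auto N \<and> m a \<Sigma> = \<Sigma>" for a by (simp add: m_def)
  have car: "carrier (AutoGroup N) = auto N" by (simp add: AutoGroup_def)
  have one: "\<one>\<^bsub>AutoGroup N\<^esub> = (\<lambda>x\<in>carrier N. x)" by (simp add: AutoGroup_def BijGroup_def)
  show ?thesis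
  proof (rule Aut.subgroupI)
    show "?S \<subseteq> carrier (AutoGroup N)" by (auto simp: car)
    have "(\<lambda>x\<in>carrier N. x) \<in> ?S" unfolding S using m_one N.id_in_auto by simp
    then show "?S \<noteq> {}" by blast
  next
    fix a assume a: "a \<in> ?S"
    then have aut: "a \<in> auto N" "inv\<^bsub>AutoGroup N\<^esub> a \<in> auto N" and "m a \<Sigma> = \<Sigma>"
      using Aut.inv_closed[of a] unfolding S car by auto
    have "m (inv\<^bsub>AutoGroup N\<^esub> a) \<Sigma> = m (inv\<^bsub>AutoGroup N\<^esub> a) (m a \<Sigma>)" by (simp add: \<open>m a \<Sigma> = \<Sigma>\<close>)
    also have "\<dots> = m (compose (carrier N) (inv\<^bsub>AutoGroup N\<^esub> a) a) \<Sigma>"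
      by (rule m_comp[symmetric]) (use aut \<Sigma> in auto)
    also have "\<dots> = \<Sigma>"
      using Aut.l_inv[of a] aut m_one by (simp add: car mult one)
    finally show "inv\<^bsub>AutoGroup N\<^esub> a \<in> ?S" unfolding S using aut by simp
  next
    fix a b assume "a \<in> ?S" "b \<in> ?S"
    then show "a \<otimes>\<^bsub>AutoGroup N\<^esub> b \<in> ?S"
      unfolding S using m_comp[of a b \<Sigma>] \<Sigma> mult[of a b] Aut.m_closed[of a b] by (simp add: car)
  qed
qed

lemma group_fan_aut:
  assumes N: "group N" and \<Sigma>: "fan N \<Sigma>"
  shows "group (fan_aut N \<Sigma>)"
proof -
  have "\<sigma> \<subseteq> carrier (lattice_real N)" if "\<sigma> \<in> \<Sigma>" for \<sigma>
    using cone_subset[OF N] \<Sigma> that by (auto simp: fan_def)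
  from group.subgroup_imp_group[OF group.AutoGroup[OF N] subgroup_fan_aut[OF N this]]
  show ?thesis by (simp add: fan_aut_def)
qed

lemma fan_aut_hom: "a \<in> carrier (fan_aut N \<Sigma>) \<Longrightarrow> a \<in> hom N N"
  by (simp add: fan_aut_def auto_def)

lemma fan_aut_mult:
  assumes "a \<in> carrier (fan_aut N \<Sigma>)" "b \<in> carrier (fan_aut N \<Sigma>)"
  shows "a \<otimes>\<^bsub>fan_aut N \<Sigma>\<^esub> b = compose (carrier N) a b"
  using assms by (simp add: fan_aut_def AutoGroup_def BijGroup_def auto_def)

lemma fan_aut_one: "\<one>\<^bsub>fan_aut N \<Sigma>\<^esub> = (\<lambda>x\<in>carrier N. x)"
  by (simp add: fan_aut_def AutoGroup_def BijGroup_def)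

section \<open>Toric automorphisms\<close>

text \<open>On \<open>N \<otimes> K\<^sup>\<times>\<close> the automorphisms of the fan act through the first factor and the Galois group
  through the second, so the two actions commute.\<close>
lemma toric_commuting_actions:
  assumes K: "finite_galois_extension K k" and N: "fg_free_abelian N" and \<Sigma>: "fan N \<Sigma>"
  shows "commuting_actions (fan_aut N \<Sigma>) (torus N K) (\<lambda>a. tensor_map N (units_of K) a id)
    (galois_group K k) (\<lambda>g. tensor_map N (units_of K) id g)"
proof -
  have "field K" "subfield k K" using K by (auto simp: finite_galois_extension_def)
  then interpret K: field K by simp
  have k: "k \<subseteq> carrier K" using \<open>subfield k K\<close> by (rule subfieldE(3))
  have N: "group N" using N by (simp add: fg_free_abelian_def comm_group_def)
  interpret N: group N by (rule N)
  interpret U: group "units_of K" by (rule K.units_group)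
  interpret tensor_factors N "units_of K"
    by (rule tensor_factors.intro[OF N.is_monoid U.is_monoid])
  interpret T: comm_group "tensor_group N (units_of K)" by (rule comm_group_tensor_group)
  interpret A: group "fan_aut N \<Sigma>" by (rule group_fan_aut[OF N \<Sigma>])
  interpret G: group "galois_group K k" by (rule group_galois_group[OF K.ring_axioms k])
  have id: "id \<in> hom N N" "id \<in> hom (units_of K) (units_of K)" by (auto simp: hom_def)
  note ghom = galois_units_hom[OF K.ring_axioms]
  have unit: "x \<in> carrier K" if "x \<in> carrier (units_of K)" for x
    using that by (simp add: units_of_carrier K.Units_closed)
  show ?thesis
    unfolding torus_def
  proof unfold_locales
    fix a assume a: "a \<in> carrier (fan_aut N \<Sigma>)"
    show "tensor_map N (units_of K) a id \<in> hom (tensor_group N (units_of K)) (tensor_group N (units_of K))"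
      by (rule tensor_map_hom[OF fan_aut_hom[OF a] id(2)])
    fix b t assume b: "b \<in> carrier (fan_aut N \<Sigma>)" and t: "t \<in> carrier (tensor_group N (units_of K))"
    show "tensor_map N (units_of K) (a \<otimes>\<^bsub>fan_aut N \<Sigma>\<^esub> b) id t =
        tensor_map N (units_of K) a id (tensor_map N (units_of K) b id t)"
      by (rule tensor_map_comp[OF fan_aut_hom[OF a] id(2) fan_aut_hom[OF b] id(2) _ _ t])
        (simp_all add: fan_aut_mult[OF a b] compose_def)
  next
    fix t assume t: "t \<in> carrier (tensor_group N (units_of K))"
    show "tensor_map N (units_of K) \<one>\<^bsub>fan_aut N \<Sigma>\<^esub> id t = t"
      by (rule tensor_map_id[OF _ _ t]) (simp_all add: fan_aut_one)
    show "tensor_map N (units_of K) id \<one>\<^bsub>galois_group K k\<^esub> t = t"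
      by (rule tensor_map_id[OF _ _ t]) (simp_all add: galois_group_one unit)
  next
    fix g assume g: "g \<in> carrier (galois_group K k)"
    show "tensor_map N (units_of K) id g \<in> hom (tensor_group N (units_of K)) (tensor_group N (units_of K))"
      by (rule tensor_map_hom[OF id(1) ghom[OF g]])
    fix h t assume h: "h \<in> carrier (galois_group K k)" and t: "t \<in> carrier (tensor_group N (units_of K))"
    show "tensor_map N (units_of K) id (g \<otimes>\<^bsub>galois_group K k\<^esub> h) t =
        tensor_map N (units_of K) id g (tensor_map N (units_of K) id h t)"
      by (rule tensor_map_comp[OF id(1) ghom[OF g] id(1) ghom[OF h] _ _ t])
        (simp_all add: galois_group_mult[OF g h] compose_def unit)
  next
    fix a g t assume a: "a \<in> carrier (fan_aut N \<Sigma>)" and g: "g \<in> carrier (galois_group K k)"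
      and t: "t \<in> carrier (tensor_group N (units_of K))"
    show "tensor_map N (units_of K) a id (tensor_map N (units_of K) id g t) =
        tensor_map N (units_of K) id g (tensor_map N (units_of K) a id t)"
      using tensor_map_comp[OF fan_aut_hom[OF a] id(2) id(1) ghom[OF g], of a g t]
        tensor_map_comp[OF id(1) ghom[OF g] fan_aut_hom[OF a] id(2), of a g t] t by simp
  qed
qed

text \<open>The diagonal action splits into its two factors, which exhibits it as the action twisted
  by \<open>\<phi>\<close>.\<close>
lemma twisted_torus_act_eq:
  assumes K: "finite_galois_extension K k" and N: "fg_free_abelian N"
    and \<phi>: "\<phi> \<in> ext_hom (galois_group K k) (fan_aut N \<Sigma>)"
    and g: "g \<in> carrier (galois_group K k)" and t: "t \<in> carrier (torus N K)"
  shows "twisted_torus_act N K \<phi> g t =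
    tensor_map N (units_of K) (\<phi> g) id (tensor_map N (units_of K) id g t)"
proof -
  interpret K: field K using K by (simp add: finite_galois_extension_def)
  have N: "group N" using N by (simp add: fg_free_abelian_def comm_group_def)
  interpret tensor_factors N "units_of K"
    by (rule tensor_factors.intro[OF group.is_monoid[OF N] group.is_monoid[OF K.units_group]])
  have "\<phi> g \<in> hom N N" using \<phi> g by (intro fan_aut_hom) (auto simp: ext_hom_def hom_def)
  moreover have "id \<in> hom N N" "id \<in> hom (units_of K) (units_of K)" by (auto simp: hom_def)
  moreover note galois_units_hom[OF K.ring_axioms g]
  ultimately show ?thesis
    using t unfolding twisted_torus_act_def torus_def by (intro tensor_map_comp) simp_all
qed

theorem theorem3p4:
  fixes K :: "('a, 'b) ring_scheme" and k :: "'a set"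
    and N :: "('n, 'm) monoid_scheme" and \<Sigma> :: "'n real_ext set set"
  assumes "finite_galois_extension K k"
    and "fg_free_abelian N"
    and "fan N \<Sigma>"
  shows
    \<comment> \<open>\<open>\<pi>\<close> is the well defined map induced by the projection, and it is surjective\<close>
    "(\<forall>c \<in> Z1_toric K k N \<Sigma>.
        H1_proj K k N \<Sigma> (class_toric K k N \<Sigma> c) =
        class_fan K k N \<Sigma> (\<lambda>g \<in> carrier (galois_group K k). snd (c g)))
     \<and> H1_proj K k N \<Sigma> ` H1_toric K k N \<Sigma> = H1_fan K k N \<Sigma>
     \<comment> \<open>the fibers of \<open>\<pi>\<close>\<close>
     \<and> (\<forall>\<phi> \<in> ext_hom (galois_group K k) (fan_aut N \<Sigma>).
          H0 (galois_group K k) (fan_aut N \<Sigma>) (twisted_fan_aut_act N \<Sigma> \<phi>) =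
            centralizer (fan_aut N \<Sigma>) (\<phi> ` carrier (galois_group K k))
          \<and> group_action (fan_centralizer K k N \<Sigma> \<phi>) (H1_twisted K k N \<phi>) (centralizer_act K k N \<phi>)
          \<and> (\<forall>a \<in> carrier (fan_centralizer K k N \<Sigma> \<phi>). \<forall>t \<in> Z1_twisted K k N \<phi>.
               centralizer_act K k N \<phi> a (class_twisted K k N \<phi> t) =
               class_twisted K k N \<phi>
                 (\<lambda>g \<in> carrier (galois_group K k). tensor_map N (units_of K) a id (t g)))
          \<and> (\<forall>t \<in> Z1_twisted K k N \<phi>.
               fiber_map K k N \<Sigma> \<phi>
                 (orbit (fan_centralizer K k N \<Sigma> \<phi>) (centralizer_act K k N \<phi>) (class_twisted K k N \<phi> t)) =
               class_toric K k N \<Sigma> (pair_cocycle K k \<phi> t))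
          \<and> bij_betw (fiber_map K k N \<Sigma> \<phi>) (H1_twisted_quotient K k N \<Sigma> \<phi>)
              {C \<in> H1_toric K k N \<Sigma>. H1_proj K k N \<Sigma> C = class_fan K k N \<Sigma> \<phi>})
     \<comment> \<open>the resulting partition\<close>
     \<and> (\<forall>R. hom_class_reps (galois_group K k) (fan_aut N \<Sigma>) R \<longrightarrow>
          bij_betw (\<lambda>(\<phi>, Q). fiber_map K k N \<Sigma> \<phi> Q)
            (SIGMA \<phi>:R. H1_twisted_quotient K k N \<Sigma> \<phi>) (H1_toric K k N \<Sigma>))
     \<comment> \<open>the section of \<open>\<pi>\<close>\<close>
     \<and> (\<forall>\<phi> \<in> ext_hom (galois_group K k) (fan_aut N \<Sigma>).
          one_cocycle K k N \<phi> \<in> Z1_toric K k N \<Sigma> \<and>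
          H1_section K k N \<Sigma> (class_fan K k N \<Sigma> \<phi>) = class_toric K k N \<Sigma> (one_cocycle K k N \<phi>))
     \<and> (\<forall>C \<in> H1_fan K k N \<Sigma>.
          H1_section K k N \<Sigma> C \<in> H1_toric K k N \<Sigma> \<and>
          H1_proj K k N \<Sigma> (H1_section K k N \<Sigma> C) = C)"
proof -
  let ?G = "galois_group K k" and ?A = "fan_aut N \<Sigma>" and ?T = "torus N K"
  let ?actA = "\<lambda>a. tensor_map N (units_of K) a id" and ?actG = "\<lambda>g. tensor_map N (units_of K) id g"
  interpret commuting_actions ?A ?T ?actA ?G ?actG
    by (rule toric_commuting_actions[OF assms])
  \<comment> \<open>The groups, actions and maps of the statement are those of the abstract situation.\<close>
  have E_eq: "toric_aut N \<Sigma> K = semidirect ?T ?A ?actA" by (simp add: toric_aut_def)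
  have act_eq: "toric_act N K = (\<lambda>g (t, a). (?actG g t, a))"
    by (intro ext) (auto simp: toric_act_def)
  have twisted_eq: "cohomologous ?G ?T (twisted_torus_act N K \<phi>) = cohomologous ?G ?T (twisted_act \<phi>)"
    "Z1 ?G ?T (twisted_torus_act N K \<phi>) = Z1 ?G ?T (twisted_act \<phi>)"
    if "\<phi> \<in> ext_hom ?G ?A" for \<phi>
  proof -
    have eq: "twisted_torus_act N K \<phi> g t = twisted_act \<phi> g t" if "g \<in> carrier ?G" "t \<in> carrier ?T" for g t
      using twisted_torus_act_eq[OF assms(1,2) \<open>\<phi> \<in> ext_hom ?G ?A\<close> that] by (simp add: twisted_act_def)
    show "cohomologous ?G ?T (twisted_torus_act N K \<phi>) = cohomologous ?G ?T (twisted_act \<phi>)"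
      by (rule cohomologous_cong) (rule eq)
    show "Z1 ?G ?T (twisted_torus_act N K \<phi>) = Z1 ?G ?T (twisted_act \<phi>)"
      by (rule Z1_cong) (rule eq)
  qed
  have H1_eq: "H1_twisted K k N \<phi> = H1 ?G ?T (twisted_act \<phi>)"
    and class_eq: "class_twisted K k N \<phi> = H1_class ?G ?T (twisted_act \<phi>)"
    if "\<phi> \<in> ext_hom ?G ?A" for \<phi>
    using twisted_eq[OF that] by (auto simp: H1_def H1_class_def)
  have cent_eq: "fan_centralizer K k N \<Sigma> = hom_centralizer"
    by (intro ext) (simp add: fan_centralizer_def hom_centralizer_def)
  have cact_eq: "centralizer_act K k N \<phi> = centralizer_action \<phi>" if "\<phi> \<in> ext_hom ?G ?A" for \<phi>
    by (intro ext) (simp add: centralizer_act_def centralizer_action_def H1_eq[OF that] H1_map_def class_eq[OF that])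
  have quot_eq: "H1_twisted_quotient K k N \<Sigma> \<phi> = orbits (hom_centralizer \<phi>) (H1 ?G ?T (twisted_act \<phi>)) (centralizer_action \<phi>)"
    if "\<phi> \<in> ext_hom ?G ?A" for \<phi>
    by (simp add: H1_twisted_quotient_def cent_eq H1_eq[OF that] cact_eq[OF that])
  have pair_eq: "pair_cocycle K k = paired"
    by (intro ext) (simp add: pair_cocycle_def paired_def)
  have one_eq: "one_cocycle K k N \<phi> = paired \<phi> (\<lambda>_. \<one>\<^bsub>?T\<^esub>)" for \<phi>
    by (simp add: one_cocycle_def paired_def)
  have fiber_eq: "fiber_map K k N \<Sigma> = fiber_class"
    by (intro ext) (simp add: fiber_map_def fiber_class_def pair_eq E_eq act_eq)
  have sect_eq: "H1_section K k N \<Sigma> = split_class"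
    by (intro ext) (simp add: H1_section_def split_class_def one_eq E_eq act_eq)
  have H0_eq: "H0 ?G ?A (twisted_fan_aut_act N \<Sigma> \<phi>) = centralizer ?A (\<phi> ` carrier ?G)"
    if "\<phi> \<in> ext_hom ?G ?A" for \<phi>
    using H0_conjugation[OF that] by (simp add: H0_def twisted_fan_aut_act_def)
  note fiber = H0_eq H1_eq class_eq twisted_eq cact_eq quot_eq
  show ?thesis
    unfolding E_eq act_eq H1_proj_def cent_eq pair_eq fiber_eq sect_eq one_eq
  proof (intro conjI ballI allI impI)
    fix c assume "c \<in> Z1 ?G E actE"
    then show "\<pi> (H1_class ?G E actE c) = class_fan K k N \<Sigma> (\<lambda>g\<in>carrier ?G. snd (c g))"
      by (rule proj.H1_map_class)
  next
    show "\<pi> ` H1 ?G E actE = H1_fan K k N \<Sigma>" by (rule proj_surj)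
  next
    fix \<phi> assume \<phi>: "\<phi> \<in> ext_hom ?G ?A"
    show "H0 ?G ?A (twisted_fan_aut_act N \<Sigma> \<phi>) = centralizer ?A (\<phi> ` carrier ?G)"
      by (rule H0_eq[OF \<phi>])
    show "group_action (hom_centralizer \<phi>) (H1_twisted K k N \<phi>) (centralizer_act K k N \<phi>)"
      unfolding fiber[OF \<phi>] by (rule centralizer_group_action[OF \<phi>])
    show "bij_betw (fiber_class \<phi>) (H1_twisted_quotient K k N \<Sigma> \<phi>)
        {C \<in> H1 ?G E actE. \<pi> C = class_fan K k N \<Sigma> \<phi>}"
      unfolding fiber[OF \<phi>] by (rule bij_betw_fiber_class[OF \<phi>])
    show "paired \<phi> (\<lambda>_. \<one>\<^bsub>?T\<^esub>) \<in> Z1 ?G E actE" by (rule paired_one_in_Z1[OF \<phi>])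
    show "split_class (class_fan K k N \<Sigma> \<phi>) = H1_class ?G E actE (paired \<phi> (\<lambda>_. \<one>\<^bsub>?T\<^esub>))"
      by (rule split_class_of_hom[OF \<phi>])
    fix t assume t: "t \<in> Z1_twisted K k N \<phi>"
    then have t: "t \<in> Z1 ?G ?T (twisted_act \<phi>)" by (simp add: twisted_eq[OF \<phi>])
    show "fiber_class \<phi> (orbit (hom_centralizer \<phi>) (centralizer_act K k N \<phi>) (class_twisted K k N \<phi> t)) =
        H1_class ?G E actE (paired \<phi> t)"
      unfolding fiber[OF \<phi>] by (rule fiber_class_orbit[OF \<phi> t])
    fix a assume a: "a \<in> carrier (hom_centralizer \<phi>)"
    show "centralizer_act K k N \<phi> a (class_twisted K k N \<phi> t) =
        class_twisted K k N \<phi> (\<lambda>g\<in>carrier ?G. tensor_map N (units_of K) a id (t g))"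
      unfolding fiber[OF \<phi>] by (rule centralizer_action_class(1)[OF \<phi> a t])
  next
    fix R assume R: "hom_class_reps ?G ?A R"
    then have "\<phi> \<in> ext_hom ?G ?A" if "\<phi> \<in> R" for \<phi> using that by (auto simp: hom_class_reps_def)
    then have "(SIGMA \<phi>:R. H1_twisted_quotient K k N \<Sigma> \<phi>) =
        (SIGMA \<phi>:R. orbits (hom_centralizer \<phi>) (H1 ?G ?T (twisted_act \<phi>)) (centralizer_action \<phi>))"
      using quot_eq by (intro Sigma_cong) auto
    then show "bij_betw (\<lambda>(\<phi>, Q). fiber_class \<phi> Q) (SIGMA \<phi>:R. H1_twisted_quotient K k N \<Sigma> \<phi>) (H1 ?G E actE)"
      using bij_betw_partition[OF R] by simp
  next
    fix C assume C: "C \<in> H1_fan K k N \<Sigma>"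
    show "split_class C \<in> H1 ?G E actE" "\<pi> (split_class C) = C" by (rule proj_split_class[OF C])+
  qed
qed

end
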